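(* For all $d\in\mathbb{N}$, $$\boldsymbol{\lambda}\big(\mathcal{H}_d(\mathbb{S}^1)\big)=\frac{4}{\pi}.$$
   Context: $\mathbb{N}=\{1,2,\dots\}$. $\mathbb{S}^1$ is the Euclidean unit circle in $\mathbb{R}^2$. $\mathcal{H}_d(\mathbb{S}^1)$ is the space of restrictions to $\mathbb{S}^1$ of $d$-homogeneous harmonic polynomials on $\mathbb{R}^2$ with complex coefficients, a complex Banach space under the supremum norm on $\mathbb{S}^1$. For a subspace $X$ of a Banach space $Y$, $\boldsymbol{\lambda}(X,Y)=\inf\{\|P\|: P\in\mathcal{L}(Y,X),\ P|_X=\mathrm{id}_X\}$ (with $\inf\varnothing=\infty$). The (absolute) projection constant of $X$ is $\boldsymbol{\lambda}(X)=\sup\boldsymbol{\lambda}(I(X),Y)$, the supremum over all complex Banach spaces $Y$ and all linear isometric embeddings $I\colon X\to Y$. *)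

theory Defs
  imports "HOL-Analysis.Analysis" "HOL-Algebra.Module"
begin

section \<open>Complex Banach spaces with explicit carrier\<close>

definition complex_field :: "complex ring" where
  "complex_field = \<lparr>carrier = UNIV, mult = (*), one = 1, zero = 0, add = (+)\<rparr>"

text \<open>The fields \<open>mult\<close> and \<open>one\<close>, inherited from the record of modules, play no role.\<close>

record 'v normed_module = "(complex, 'v) module" +
  vnorm :: "'v \<Rightarrow> real"

locale complex_normed_space = module complex_field V
  for V :: "'v normed_module" (structure) +
  assumes vnorm_eq_zero: "x \<in> carrier V \<Longrightarrow> vnorm V x = 0 \<longleftrightarrow> x = \<zero>\<^bsub>V\<^esub>"
    and vnorm_triangle:
      "x \<in> carrier V \<Longrightarrow> y \<in> carrier V \<Longrightarrow> vnorm V (x \<oplus>\<^bsub>V\<^esub> y) \<le> vnorm V x + vnorm V y"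
    and vnorm_smult: "x \<in> carrier V \<Longrightarrow> vnorm V (a \<odot>\<^bsub>V\<^esub> x) = cmod a * vnorm V x"

locale complex_banach_space = complex_normed_space V for V :: "'v normed_module" (structure) +
  assumes complete: "Metric_space.mcomplete (carrier V) (\<lambda>x y. vnorm V (x \<ominus>\<^bsub>V\<^esub> y))"

definition linear_operators ::
    "'v normed_module \<Rightarrow> 'w normed_module \<Rightarrow> ('v \<Rightarrow> 'w) set" where
  "linear_operators V W = {T \<in> carrier V \<rightarrow> carrier W.
     (\<forall>x\<in>carrier V. \<forall>y\<in>carrier V. T (x \<oplus>\<^bsub>V\<^esub> y) = T x \<oplus>\<^bsub>W\<^esub> T y) \<and>
     (\<forall>a. \<forall>x\<in>carrier V. T (a \<odot>\<^bsub>V\<^esub> x) = a \<odot>\<^bsub>W\<^esub> T x)}"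

definition bounded_operators ::
    "'v normed_module \<Rightarrow> 'w normed_module \<Rightarrow> ('v \<Rightarrow> 'w) set" where
  "bounded_operators V W =
     {T \<in> linear_operators V W. \<exists>C. \<forall>x\<in>carrier V. vnorm W (T x) \<le> C * vnorm V x}"

definition operator_norm ::
    "'v normed_module \<Rightarrow> 'w normed_module \<Rightarrow> ('v \<Rightarrow> 'w) \<Rightarrow> real" where
  "operator_norm V W T = (SUP x\<in>{x \<in> carrier V. vnorm V x \<le> 1}. vnorm W (T x))"

definition isometric_embeddings ::
    "'v normed_module \<Rightarrow> 'w normed_module \<Rightarrow> ('v \<Rightarrow> 'w) set" where
  "isometric_embeddings V W =
     {I \<in> linear_operators V W. \<forall>x\<in>carrier V. vnorm W (I x) = vnorm V x}"


section \<open>Projection constants\<close>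

text \<open>
  The subspace \<open>X\<close> of \<open>Y\<close> is given by its underlying set. The value is \<open>\<infinity>\<close>
  if there is no bounded projection of \<open>Y\<close> onto \<open>X\<close>.
\<close>

definition relative_projection_constant :: "'v set \<Rightarrow> 'v normed_module \<Rightarrow> ereal" where
  "relative_projection_constant X Y =
     (INF P\<in>{P \<in> bounded_operators Y (Y\<lparr>carrier := X\<rparr>). \<forall>x\<in>X. P x = x}.
        ereal (operator_norm Y (Y\<lparr>carrier := X\<rparr>) P))"

text \<open>
  A formula of HOL cannot quantify over all Banach spaces, only over those whose elements are
  drawn from a given type. Here this is the type \<open>'v + 'y\<close>, where \<open>'v\<close> is the type that \<open>X\<close>
  lives in and \<open>'y\<close> is a parameter. Up to isometric isomorphism this covers \<open>X\<close> itself and all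
  Banach spaces on a subset of \<open>'y\<close>. A statement that leaves \<open>'y\<close> schematic therefore speaks
  about all Banach spaces.
\<close>

definition projection_constant :: "'y itself \<Rightarrow> 'v normed_module \<Rightarrow> ereal" where
  "projection_constant _ X =
     (SUP (Y, I)\<in>{(Y :: ('v + 'y) normed_module, I).
                     complex_banach_space Y \<and> I \<in> isometric_embeddings X Y}.
        relative_projection_constant (I ` carrier X) Y)"


section \<open>Circular harmonics\<close>

abbreviation unit_circle :: "(real^2) set" where
  "unit_circle \<equiv> sphere 0 1"

definition homogeneous_polynomials :: "nat \<Rightarrow> (real^2 \<Rightarrow> complex) set" where
  "homogeneous_polynomials d = {p. \<exists>c :: nat \<Rightarrow> complex.
     p = (\<lambda>x. \<Sum>k\<le>d. c k * complex_of_real (x $ 1) ^ k * complex_of_real (x $ 2) ^ (d - k))}"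

definition partial_derivative :: "2 \<Rightarrow> (real^2 \<Rightarrow> complex) \<Rightarrow> real^2 \<Rightarrow> complex" where
  "partial_derivative i f x = vector_derivative (\<lambda>t. f (x + t *\<^sub>R axis i 1)) (at 0)"

definition laplacian :: "(real^2 \<Rightarrow> complex) \<Rightarrow> real^2 \<Rightarrow> complex" where
  "laplacian f x = (\<Sum>i\<in>UNIV. partial_derivative i (partial_derivative i f) x)"

definition circular_harmonics :: "nat \<Rightarrow> (real^2 \<Rightarrow> complex) normed_module" where
  "circular_harmonics d =
     \<lparr>carrier = {restrict p unit_circle | p.
                   p \<in> homogeneous_polynomials d \<and> (\<forall>x. laplacian p x = 0)},
      mult = undefined, one = undefined,
      zero = (\<lambda>x\<in>unit_circle. 0),
      add = (\<lambda>f g. \<lambda>x\<in>unit_circle. f x + g x),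
      smult = (\<lambda>a f. \<lambda>x\<in>unit_circle. a * f x),
      vnorm = (\<lambda>f. SUP x\<in>unit_circle. cmod (f x))\<rparr>"

end

theory Submission
  imports Defs "HOL-Real_Asymp.Real_Asymp"
begin

text \<open>
  Write \<open>u = (x + iy)\<^sup>d\<close>. On the circle the harmonics are the combinations of \<open>u\<close> and its conjugate,
  and convolution with the kernel \<open>2 Re u\<close> reproduces them; its \<open>L\<^sup>1\<close>-norm is the mean of
  \<open>2\<bar>cos\<bar>\<close>, that is \<open>4/\<pi>\<close>. For the upper bound the convolution is discretized over the \<open>n\<close>-th roots
  of unity, which still reproduces \<open>u\<close> and its conjugate exactly, and the finitely many point
  evaluations are extended to \<open>Y\<close> by Hahn-Banach. For the lower bound take for \<open>Y\<close> the bounded functions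
  on the circle: averaging an arbitrary projection over rotations leaves the Fourier projection,
  which is tested on Fejer means of \<open>sgn (Re u)\<close>. Both bounds are equal to \<open>4/\<pi>\<close> in the limit \<open>n \<rightarrow> \<infinity>\<close>.
\<close>

section \<open>The Hahn-Banach theorem\<close>

text \<open>Sums over roots of unity replace integrals because neither side offers a measurable
  integrand: the extended point evaluations are chosen separately for each point, and the values of
  an arbitrary projection on rotated functions need not depend measurably on the angle. The price is
  aliasing, since such sums see frequencies only modulo \<open>n\<close>. For the upper bound only
  the frequencies 1 and -1 have to be told apart. For the lower bound the sign of
  \<open>Re u\<close> would be extremal, but it has infinitely many frequencies and its Fourier
  series does not converge uniformly. Its Fejer mean has only frequencies of modulus below
  \<open>m = n / 2\<close>, so finite linearity and exact orthogonality suffice, and it stays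
  bounded by 1 because the kernel is nonnegative. The mean damps the frequencies 1 and -1 by
  \<open>(m - 1) / m\<close>, a loss that disappears in the limit. The sums of |cos| that arise are
  bounded through a closed form instead of a convergence theorem for Riemann sums.\<close>

lemma complex_field_simps [simp]:
  "carrier complex_field = UNIV" "mult complex_field = (*)" "one complex_field = 1"
  "zero complex_field = 0" "add complex_field = (+)"
  by (simp_all add: complex_field_def)

lemma cring_complex_field: "cring complex_field"
proof (rule cringI)
  show "abelian_group complex_field"
    by (rule abelian_groupI) (auto simp: add.assoc add.commute intro: exI[of _ "- x" for x])
  show "comm_monoid complex_field"
    by (rule comm_monoidI) (auto simp: mult.assoc mult.commute)
qed (simp add: distrib_right)

section \<open>Norm-preserving extension of functionals\<close>

context complex_normed_space
begin

lemma smult_complex: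
  assumes "x \<in> carrier V"
  shows "a \<odot>\<^bsub>V\<^esub> x \<in> carrier V"
    and "(a + b) \<odot>\<^bsub>V\<^esub> x = a \<odot>\<^bsub>V\<^esub> x \<oplus>\<^bsub>V\<^esub> b \<odot>\<^bsub>V\<^esub> x"
    and "y \<in> carrier V \<Longrightarrow> a \<odot>\<^bsub>V\<^esub> (x \<oplus>\<^bsub>V\<^esub> y) = a \<odot>\<^bsub>V\<^esub> x \<oplus>\<^bsub>V\<^esub> a \<odot>\<^bsub>V\<^esub> y"
    and "a \<odot>\<^bsub>V\<^esub> (b \<odot>\<^bsub>V\<^esub> x) = (a * b) \<odot>\<^bsub>V\<^esub> x"
    and "1 \<odot>\<^bsub>V\<^esub> x = x"
    and "0 \<odot>\<^bsub>V\<^esub> x = \<zero>\<^bsub>V\<^esub>"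
  using assms smult_closed[of a x] smult_l_distr[of a b x] smult_r_distr[of a x y]
    smult_assoc1[of a b x] smult_one[of x] smult_l_null[of x]
  by simp_all

lemma vnorm_zero [simp]: "vnorm V \<zero>\<^bsub>V\<^esub> = 0"
  by (simp add: vnorm_eq_zero)

text \<open>Partial real-linear functionals are encoded by their graphs, so that extension is
  inclusion and a nonempty chain has its union as upper bound. Only real scalars act here; the
  complex functional is recovered from its real part at the end.\<close>

definition dominated_graph :: "('v \<times> real) set \<Rightarrow> bool" where
  "dominated_graph G \<longleftrightarrow> G \<subseteq> carrier V \<times> UNIV \<and> (\<zero>\<^bsub>V\<^esub>, 0) \<in> G \<and>
     (\<forall>x a y b. (x, a) \<in> G \<longrightarrow> (y, b) \<in> G \<longrightarrow> (x \<oplus>\<^bsub>V\<^esub> y, a + b) \<in> G) \<and>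
     (\<forall>t x a. (x, a) \<in> G \<longrightarrow> (complex_of_real t \<odot>\<^bsub>V\<^esub> x, t * a) \<in> G) \<and>
     (\<forall>x a. (x, a) \<in> G \<longrightarrow> a \<le> vnorm V x)"

lemma dominated_graphD:
  assumes "dominated_graph G"
  shows "(x, a) \<in> G \<Longrightarrow> x \<in> carrier V"
    and "(\<zero>\<^bsub>V\<^esub>, 0) \<in> G"
    and "(x, a) \<in> G \<Longrightarrow> (y, b) \<in> G \<Longrightarrow> (x \<oplus>\<^bsub>V\<^esub> y, a + b) \<in> G"
    and "(x, a) \<in> G \<Longrightarrow> (complex_of_real t \<odot>\<^bsub>V\<^esub> x, t * a) \<in> G"
    and "(x, a) \<in> G \<Longrightarrow> a \<le> vnorm V x"
  using assms unfolding dominated_graph_def by blast+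

text \<open>A linear graph below the norm is automatically single-valued, since it contains
  \<open>(0, t * (a - b))\<close> for all real \<open>t\<close> as soon as it contains \<open>(x, a)\<close> and \<open>(x, b)\<close>.\<close>

lemma dominated_graph_unique:
  assumes "dominated_graph G" "(x, a) \<in> G" "(x, b) \<in> G"
  shows "a = b"
proof -
  note D = dominated_graphD[OF assms(1)]
  have "p \<le> q" if pq: "(x, p) \<in> G" "(x, q) \<in> G" for p q
  proof -
    have x: "x \<in> carrier V" using D(1) pq by blast
    have "(x \<oplus>\<^bsub>V\<^esub> complex_of_real (-1) \<odot>\<^bsub>V\<^esub> x, p + (-1) * q) \<in> G"
      by (intro D(3) D(4) pq)
    moreover have "x \<oplus>\<^bsub>V\<^esub> complex_of_real (-1) \<odot>\<^bsub>V\<^esub> x = \<zero>\<^bsub>V\<^esub>"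
      using smult_complex(2)[OF x, of 1 "-1"] by (simp add: smult_complex x)
    ultimately have "p + (-1) * q \<le> 0"
      using D(5) by (metis vnorm_zero)
    then show ?thesis by simp
  qed
  then show ?thesis using assms by (simp add: order_antisym)
qed

text \<open>A value \<open>c\<close> at \<open>y\<close> has to lie above all
  \<open>a - norm (x - y)\<close> and below all \<open>norm (x' + y) - b\<close>. The triangle
  inequality makes these bounds compatible, and the supremum of the lower ones is taken. If
  \<open>y\<close> is already in the domain of \<open>M\<close>, they force \<open>c\<close> to be
  its value there, so no case distinction arises.\<close>

lemma dominated_graph_extend:
  assumes M: "dominated_graph M" and y: "y \<in> carrier V"
  shows "\<exists>c G. dominated_graph G \<and> M \<subseteq> G \<and> (y, c) \<in> G"
proof -
  note D = dominated_graphD[OF M]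
  define S where "S = {a - vnorm V (x \<oplus>\<^bsub>V\<^esub> (-1) \<odot>\<^bsub>V\<^esub> y) | x a. (x, a) \<in> M}"
  have key: "a - vnorm V (x \<oplus>\<^bsub>V\<^esub> (-1) \<odot>\<^bsub>V\<^esub> y) \<le> vnorm V (x' \<oplus>\<^bsub>V\<^esub> y) - b"
    if "(x, a) \<in> M" "(x', b) \<in> M" for x a x' b
  proof -
    have c: "x \<in> carrier V" "x' \<in> carrier V" using that D(1) by blast+
    have "x \<oplus>\<^bsub>V\<^esub> x' = (x \<oplus>\<^bsub>V\<^esub> x') \<oplus>\<^bsub>V\<^esub> ((-1 + 1) \<odot>\<^bsub>V\<^esub> y)"
      using c y by (simp add: smult_complex)
    also have "\<dots> = (x \<oplus>\<^bsub>V\<^esub> (-1) \<odot>\<^bsub>V\<^esub> y) \<oplus>\<^bsub>V\<^esub> (x' \<oplus>\<^bsub>V\<^esub> y)"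
      using c y smult_complex(2)[OF y, of "-1" 1] by (simp add: smult_complex M.a_ac del: add.left_inverse)
    finally have "vnorm V (x \<oplus>\<^bsub>V\<^esub> x') \<le> vnorm V (x \<oplus>\<^bsub>V\<^esub> (-1) \<odot>\<^bsub>V\<^esub> y) + vnorm V (x' \<oplus>\<^bsub>V\<^esub> y)"
      using c y vnorm_triangle by (simp add: smult_complex)
    moreover have "a + b \<le> vnorm V (x \<oplus>\<^bsub>V\<^esub> x')" using D(3,5) that by blast
    ultimately show ?thesis by simp
  qed
  define c where "c = Sup S"
  have bdd: "bdd_above S" and ne: "S \<noteq> {}"
    using key[OF _ D(2)] D(2) unfolding S_def bdd_above_def by fastforce+
  have lo: "a - c \<le> vnorm V (x \<oplus>\<^bsub>V\<^esub> (-1) \<odot>\<^bsub>V\<^esub> y)" if "(x, a) \<in> M" for x a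
  proof -
    have "a - vnorm V (x \<oplus>\<^bsub>V\<^esub> (-1) \<odot>\<^bsub>V\<^esub> y) \<le> c"
      unfolding c_def using that by (intro cSup_upper bdd) (auto simp: S_def)
    then show ?thesis by simp
  qed
  have hi: "a + c \<le> vnorm V (x \<oplus>\<^bsub>V\<^esub> y)" if "(x, a) \<in> M" for x a
  proof -
    have "c \<le> vnorm V (x \<oplus>\<^bsub>V\<^esub> y) - a"
      unfolding c_def using that key by (intro cSup_least ne) (auto simp: S_def)
    then show ?thesis by simp
  qed
  \<comment> \<open>By homogeneity the bounds for \<open>y\<close> and \<open>-y\<close> are enough:
    for other \<open>t \<noteq> 0\<close> they are used at \<open>x / \<bar>t\<bar>\<close> and
    scaled by \<open>\<bar>t\<bar>\<close>.\<close>
  have scale: "s * (a + e * c) \<le> vnorm V (complex_of_real s \<odot>\<^bsub>V\<^esub> (x \<oplus>\<^bsub>V\<^esub> complex_of_real e \<odot>\<^bsub>V\<^esub> y))"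
    if "(x, a) \<in> M" "s > 0" "e = 1 \<or> e = -1" for x a s e
  proof -
    have "x \<oplus>\<^bsub>V\<^esub> complex_of_real e \<odot>\<^bsub>V\<^esub> y \<in> carrier V"
      using that D(1) y by (simp add: smult_complex)
    then have "vnorm V (complex_of_real s \<odot>\<^bsub>V\<^esub> (x \<oplus>\<^bsub>V\<^esub> complex_of_real e \<odot>\<^bsub>V\<^esub> y))
        = s * vnorm V (x \<oplus>\<^bsub>V\<^esub> complex_of_real e \<odot>\<^bsub>V\<^esub> y)"
      using that by (simp add: vnorm_smult)
    moreover have "a + e * c \<le> vnorm V (x \<oplus>\<^bsub>V\<^esub> complex_of_real e \<odot>\<^bsub>V\<^esub> y)"
      using that(3) lo[OF that(1)] hi[OF that(1)] y by (auto simp: smult_complex)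
    ultimately show ?thesis using that(2) by simp
  qed
  have dom: "a + t * c \<le> vnorm V (x \<oplus>\<^bsub>V\<^esub> complex_of_real t \<odot>\<^bsub>V\<^esub> y)" if xa: "(x, a) \<in> M" for x a t
  proof (cases "t = 0")
    case True
    then show ?thesis using D(1,5) xa y by (auto simp: smult_complex)
  next
    case False
    have x: "x \<in> carrier V" using xa D(1) by blast
    define s where "s = \<bar>t\<bar>"
    define e where "e = sgn t"
    have s: "s > 0" "s * e = t" "e = 1 \<or> e = -1"
      using False by (auto simp: s_def e_def sgn_if)
    have "(complex_of_real (1/s) \<odot>\<^bsub>V\<^esub> x, (1/s) * a) \<in> M" by (rule D(4)[OF xa])
    from scale[OF this s(1,3)] s x y
    show ?thesis
      by (simp add: smult_complex distrib_left flip: of_real_mult mult.assoc)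
  qed
  define G where "G = {(x \<oplus>\<^bsub>V\<^esub> complex_of_real t \<odot>\<^bsub>V\<^esub> y, a + t * c) | x a t. (x, a) \<in> M}"
  have GI: "(x', a') \<in> G"
    if "(x, a) \<in> M" "x' = x \<oplus>\<^bsub>V\<^esub> complex_of_real t \<odot>\<^bsub>V\<^esub> y" "a' = a + t * c" for x a t x' a'
    using that unfolding G_def by blast
  have "dominated_graph G"
    unfolding dominated_graph_def
  proof (intro conjI allI impI)
    show "G \<subseteq> carrier V \<times> UNIV"
      unfolding G_def using y D(1) by (auto simp: smult_complex)
    show "(\<zero>\<^bsub>V\<^esub>, 0) \<in> G"
      using y by (intro GI[OF D(2), of _ 0]) (auto simp: smult_complex)
  next
    fix x1 a1 x2 a2 assume "(x1, a1) \<in> G" "(x2, a2) \<in> G"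
    then obtain x a t x' a' t' where *: "(x, a) \<in> M" "x1 = x \<oplus>\<^bsub>V\<^esub> complex_of_real t \<odot>\<^bsub>V\<^esub> y" "a1 = a + t * c"
        "(x', a') \<in> M" "x2 = x' \<oplus>\<^bsub>V\<^esub> complex_of_real t' \<odot>\<^bsub>V\<^esub> y" "a2 = a' + t' * c"
      unfolding G_def by blast
    have c: "x \<in> carrier V" "x' \<in> carrier V" using * D(1) by blast+
    show "(x1 \<oplus>\<^bsub>V\<^esub> x2, a1 + a2) \<in> G"
      using c y * by (intro GI[OF D(3)[OF *(1,4)], of _ "t + t'"])
        (auto simp: smult_complex M.a_ac algebra_simps)
  next
    fix r x1 a1 assume "(x1, a1) \<in> G"
    then obtain x a t where *: "(x, a) \<in> M" "x1 = x \<oplus>\<^bsub>V\<^esub> complex_of_real t \<odot>\<^bsub>V\<^esub> y" "a1 = a + t * c"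
      unfolding G_def by blast
    have c: "x \<in> carrier V" using * D(1) by blast
    show "(complex_of_real r \<odot>\<^bsub>V\<^esub> x1, r * a1) \<in> G"
      using c y * by (intro GI[OF D(4)[OF *(1), of r], of _ "r * t"]) (auto simp: smult_complex algebra_simps)
  next
    fix x a assume "(x, a) \<in> G" then show "a \<le> vnorm V x"
      unfolding G_def using dom by blast
  qed
  moreover have "M \<subseteq> G"
  proof (rule subrelI)
    fix x a assume "(x, a) \<in> M" then show "(x, a) \<in> G"
      using y D(1) by (intro GI[of x a _ 0]) (auto simp: smult_complex)
  qed
  moreover have "(y, c) \<in> G"
    using y by (intro GI[OF D(2), of _ 1]) (auto simp: smult_complex)
  ultimately show ?thesis by blast
qed

text \<open>Zorn's lemma yields a maximal graph; since the one-step extension at any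
  \<open>y\<close> cannot be proper, its domain is all of \<open>carrier V\<close>.\<close>

lemma dominated_graph_total:
  assumes G: "dominated_graph G"
  shows "\<exists>M. dominated_graph M \<and> G \<subseteq> M \<and> (\<forall>y\<in>carrier V. \<exists>!a. (y, a) \<in> M)"
proof -
  let ?A = "{M. dominated_graph M \<and> G \<subseteq> M}"
  have "\<exists>M\<in>?A. \<forall>X\<in>?A. M \<subseteq> X \<longrightarrow> X = M"
  proof (rule subset_Zorn_nonempty)
    show "?A \<noteq> {}" using G by blast
    fix C assume ne: "C \<noteq> {}" and chain: "subset.chain ?A C"
    have dg: "dominated_graph X" "G \<subseteq> X" if "X \<in> C" for X
      using that chain by (auto simp: subset.chain_def)
    have lin: "\<exists>X\<in>C. p \<in> X \<and> q \<in> X" if "p \<in> \<Union>C" "q \<in> \<Union>C" for p q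
      using that chain unfolding subset.chain_def by blast
    have "dominated_graph (\<Union>C)"
      unfolding dominated_graph_def
    proof (intro conjI allI impI)
      show "\<Union>C \<subseteq> carrier V \<times> UNIV"
        using dg unfolding dominated_graph_def by blast
      show "(\<zero>\<^bsub>V\<^esub>, 0) \<in> \<Union>C" using ne dg dominated_graphD(2) by blast
      show "(x \<oplus>\<^bsub>V\<^esub> y, a + b) \<in> \<Union>C" if "(x, a) \<in> \<Union>C" "(y, b) \<in> \<Union>C" for x a y b
        using lin[OF that] dg dominated_graphD(3) by blast
      show "(complex_of_real t \<odot>\<^bsub>V\<^esub> x, t * a) \<in> \<Union>C" if "(x, a) \<in> \<Union>C" for t x a
        using that dg dominated_graphD(4) by blast
      show "a \<le> vnorm V x" if "(x, a) \<in> \<Union>C" for x a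
        using that dg dominated_graphD(5) by blast
    qed
    then show "\<Union>C \<in> ?A" using ne dg by blast
  qed
  then obtain M where "M \<in> ?A" and max': "\<forall>X\<in>?A. M \<subseteq> X \<longrightarrow> X = M" by (rule bexE)
  then have M: "dominated_graph M" "G \<subseteq> M" by simp_all
  have max: "X = M" if "dominated_graph X" "M \<subseteq> X" for X
    using max' that order_trans[OF M(2) that(2)] by simp
  have "\<exists>!a. (y, a) \<in> M" if "y \<in> carrier V" for y
  proof (rule ex_ex1I)
    show "\<exists>a. (y, a) \<in> M" using dominated_graph_extend[OF M(1) that] max by metis
  qed (rule dominated_graph_unique[OF M(1)])
  with M show ?thesis by blast
qed

text \<open>Giving the functional as a graph avoids a proof that it is well defined: by
  \<open>bound\<close> the only value at the zero vector is 0, and linearity does the rest.\<close>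

theorem hahn_banach:
  fixes G :: "('v \<times> complex) set"
  assumes carrier: "G \<subseteq> carrier V \<times> UNIV" and zero: "(\<zero>\<^bsub>V\<^esub>, 0) \<in> G"
    and add: "\<And>x a y b. (x, a) \<in> G \<Longrightarrow> (y, b) \<in> G \<Longrightarrow> (x \<oplus>\<^bsub>V\<^esub> y, a + b) \<in> G"
    and smult: "\<And>c x a. (x, a) \<in> G \<Longrightarrow> (c \<odot>\<^bsub>V\<^esub> x, c * a) \<in> G"
    and bound: "\<And>x a. (x, a) \<in> G \<Longrightarrow> cmod a \<le> vnorm V x"
  obtains F :: "'v \<Rightarrow> complex" where
    "\<And>x y. x \<in> carrier V \<Longrightarrow> y \<in> carrier V \<Longrightarrow> F (x \<oplus>\<^bsub>V\<^esub> y) = F x + F y"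
    "\<And>c x. x \<in> carrier V \<Longrightarrow> F (c \<odot>\<^bsub>V\<^esub> x) = c * F x"
    "\<And>x. x \<in> carrier V \<Longrightarrow> cmod (F x) \<le> vnorm V x"
    "\<And>x a. (x, a) \<in> G \<Longrightarrow> F x = a"
proof -
  define R where "R = (\<lambda>(x, a). (x, Re a)) ` G"
  have RI: "(x, b) \<in> R" if "(x, a) \<in> G" "b = Re a" for x a b
    using imageI[OF that(1), of "\<lambda>(x, a). (x, Re a)"] that(2) by (simp add: R_def)
  have "dominated_graph R"
    unfolding dominated_graph_def
  proof (intro conjI allI impI)
    show "R \<subseteq> carrier V \<times> UNIV" using carrier unfolding R_def by auto
    show "(\<zero>\<^bsub>V\<^esub>, 0) \<in> R" by (rule RI[OF zero]) simp
    fix x a assume xa: "(x, a) \<in> R"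
    then obtain z where z: "(x, z) \<in> G" "a = Re z" unfolding R_def by auto
    show "a \<le> vnorm V x" using bound[OF z(1)] complex_Re_le_cmod[of z] z(2) by linarith
    show "(complex_of_real t \<odot>\<^bsub>V\<^esub> x, t * a) \<in> R" for t
      by (rule RI[OF smult[OF z(1)]]) (simp add: z)
    fix y b assume "(y, b) \<in> R"
    then obtain w where w: "(y, w) \<in> G" "b = Re w" unfolding R_def by auto
    show "(x \<oplus>\<^bsub>V\<^esub> y, a + b) \<in> R"
      by (rule RI[OF add[OF z(1) w(1)]]) (simp add: z w)
  qed
  from dominated_graph_total[OF this]
  obtain M where M: "dominated_graph M" "R \<subseteq> M" and tot: "\<forall>y\<in>carrier V. \<exists>!a. (y, a) \<in> M"
    by (elim exE conjE)
  note D = dominated_graphD[OF M(1)]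
  define u where "u y = (THE a. (y, a) \<in> M)" for y
  have uM: "(y, u y) \<in> M" if "y \<in> carrier V" for y
    unfolding u_def by (rule theI'[OF bspec[OF tot that]])
  have u_eq: "u y = a" if "(y, a) \<in> M" for y a
    using dominated_graph_unique[OF M(1) uM that] D(1) that by blast
  have u_add: "u (x \<oplus>\<^bsub>V\<^esub> y) = u x + u y" if "x \<in> carrier V" "y \<in> carrier V" for x y
    by (intro u_eq D(3) uM that)
  have u_smult: "u (complex_of_real t \<odot>\<^bsub>V\<^esub> x) = t * u x" if "x \<in> carrier V" for t x
    by (intro u_eq D(4) uM that)
  have u_le: "u x \<le> vnorm V x" if "x \<in> carrier V" for x
    by (intro D(5) uM that)
  \<comment> \<open>A complex-linear functional with real part \<open>u\<close> has imaginary part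
    \<open>- u (\<i> x)\<close>, so this is the only candidate.\<close>
  define F where "F x = complex_of_real (u x) - \<i> * u (\<i> \<odot>\<^bsub>V\<^esub> x)" for x
  have F_add: "F (x \<oplus>\<^bsub>V\<^esub> y) = F x + F y" if "x \<in> carrier V" "y \<in> carrier V" for x y
    using that by (simp add: F_def u_add smult_complex algebra_simps)
  have F_smult: "F (c \<odot>\<^bsub>V\<^esub> x) = c * F x" if x: "x \<in> carrier V" for c x
  proof -
    have split: "u ((complex_of_real p + complex_of_real q * \<i>) \<odot>\<^bsub>V\<^esub> x) = p * u x + q * u (\<i> \<odot>\<^bsub>V\<^esub> x)" for p q
      using x by (simp add: smult_complex(2) u_add smult_complex(1) u_smult flip: smult_complex(4))
    have "c = complex_of_real (Re c) + complex_of_real (Im c) * \<i>"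
      by (simp add: complex_eq_iff)
    moreover have "\<i> * c = complex_of_real (- Im c) + complex_of_real (Re c) * \<i>"
      by (simp add: complex_eq_iff)
    ultimately have "u (c \<odot>\<^bsub>V\<^esub> x) = Re c * u x + Im c * u (\<i> \<odot>\<^bsub>V\<^esub> x)"
      "u ((\<i> * c) \<odot>\<^bsub>V\<^esub> x) = - Im c * u x + Re c * u (\<i> \<odot>\<^bsub>V\<^esub> x)"
      using split by metis+
    then show ?thesis using x by (simp add: F_def smult_complex complex_eq_iff)
  qed
  show ?thesis
  proof (rule that)
    show "F (x \<oplus>\<^bsub>V\<^esub> y) = F x + F y" if "x \<in> carrier V" "y \<in> carrier V" for x y
      using that by (rule F_add)
    show "F (c \<odot>\<^bsub>V\<^esub> x) = c * F x" if "x \<in> carrier V" for c x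
      using that by (rule F_smult)
    show "cmod (F x) \<le> vnorm V x" if x: "x \<in> carrier V" for x
    proof (cases "F x = 0")
      case True
      \<comment> \<open>The bounds for \<open>u\<close> at \<open>x\<close> and at \<open>-x\<close>
        together give nonnegativity of the norm.\<close>
      moreover have "0 \<le> vnorm V x"
        using u_le[OF x] u_le[of "complex_of_real (-1) \<odot>\<^bsub>V\<^esub> x"] u_smult[OF x, of "-1"] vnorm_smult[OF x, of "-1"] x
        by (simp add: smult_complex)
      ultimately show ?thesis by simp
    next
      case False
      \<comment> \<open>Rotating \<open>F x\<close> onto the positive real axis turns it into a
        value of \<open>u\<close>, whose bound is known; the rotation leaves the norm of
        \<open>x\<close> unchanged.\<close>
      define c where "c = cnj (F x) / cmod (F x)"
      have c: "cmod c = 1" using False by (simp add: c_def norm_divide)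
      have "complex_of_real (cmod (F x)) = c * F x"
        using False complex_norm_square[of "F x"] by (simp add: c_def field_simps power2_eq_square)
      also have "\<dots> = F (c \<odot>\<^bsub>V\<^esub> x)" using F_smult x by simp
      finally have "cmod (F x) = u (c \<odot>\<^bsub>V\<^esub> x)" by (simp add: F_def complex_eq_iff)
      also have "\<dots> \<le> vnorm V (c \<odot>\<^bsub>V\<^esub> x)" by (rule u_le) (simp add: x smult_complex)
      finally show ?thesis using x c by (simp add: vnorm_smult)
    qed
    show "F x = a" if xa: "(x, a) \<in> G" for x a
    proof -
      have "(x, Re a) \<in> R" by (rule RI[OF xa refl])
      moreover have "(\<i> \<odot>\<^bsub>V\<^esub> x, - Im a) \<in> R" by (rule RI[OF smult[OF xa]]) simp
      ultimately have "u x = Re a" "u (\<i> \<odot>\<^bsub>V\<^esub> x) = - Im a" using M(2) u_eq by blast+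
      then show ?thesis by (simp add: F_def complex_eq_iff)
    qed
  qed
qed

end

section \<open>Discrete trigonometric sums\<close>

definition root_of_unity :: "nat \<Rightarrow> nat \<Rightarrow> complex" where
  "root_of_unity n k = cis (2 * pi * real k / real n)"

lemma norm_root_of_unity [simp]: "cmod (root_of_unity n k) = 1"
  by (simp add: root_of_unity_def)

lemma unimodular_mult_cnj: "cmod u = 1 \<Longrightarrow> u * cnj u = 1"
  by (metis complex_norm_square of_real_1 power_one)

text \<open>A geometric sum whose ratio \<open>r\<close> is an \<open>n\<close>-th root of 1.
  Exponents below \<open>n\<close> prevent distinct frequencies from coinciding modulo
  \<open>n\<close>; a separate exponent for the conjugate keeps all powers natural.\<close>

lemma sum_root_of_unity:
  assumes ab: "a < n" "b < n"
  shows "(\<Sum>k<n. root_of_unity n k ^ a * cnj (root_of_unity n k) ^ b) = (if a = b then of_nat n else 0)"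
proof (cases "a = b")
  case True
  then show ?thesis
    by (simp add: unimodular_mult_cnj flip: power_mult_distrib)
next
  case False
  define r where "r = root_of_unity n a * cnj (root_of_unity n b)"
  have n: "n > 0" using ab by simp
  have r1: "root_of_unity n c ^ n = 1" for c
  proof -
    have "root_of_unity n c ^ n = cis (2 * pi * real c)"
      unfolding root_of_unity_def Complex.DeMoivre using n by simp
    also have "\<dots> = 1"
      by (rule cis_multiple_2pi) simp
    finally show ?thesis .
  qed
  have "root_of_unity n a \<noteq> root_of_unity n b"
    using bij_betw_imp_inj_on[OF Complex.bij_betw_roots_unity[OF n]] ab False
    unfolding root_of_unity_def inj_on_def by blast
  then have "r \<noteq> 1"
    unfolding r_def using unimodular_mult_cnj[OF norm_root_of_unity[of n b]]
    by (metis mult.commute mult.left_commute mult.right_neutral)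
  moreover have "r ^ n = 1"
    unfolding r_def by (simp add: power_mult_distrib r1 flip: complex_cnj_power)
  moreover have "root_of_unity n k ^ a * cnj (root_of_unity n k) ^ b = r ^ k" for k
    by (simp add: r_def root_of_unity_def cis_cnj power_mult_distrib Complex.DeMoivre ac_simps)
  ultimately show ?thesis using False
    by (simp add: geometric_sum)
qed

section \<open>Riemann sums of |cos| over half a turn\<close>

definition cos_sum :: "nat \<Rightarrow> real \<Rightarrow> real" where
  "cos_sum m t = (\<Sum>j<m. \<bar>cos (t + pi * real j / real m)\<bar>)"

text \<open>Each term moves to the next one, and the new last term equals the lost first one because
  |cos| has period \<open>pi\<close>.\<close>

lemma cos_sum_shift_one:
  assumes "m > 0"
  shows "cos_sum m (t + pi / real m) = cos_sum m t"
proof -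
  let ?f = "\<lambda>j. \<bar>cos (t + pi * real j / real m)\<bar>"
  have "cos_sum m (t + pi / real m) = (\<Sum>j<m. ?f (Suc j))"
    unfolding cos_sum_def by (simp add: algebra_simps add_divide_distrib)
  also have "\<dots> = (\<Sum>j<Suc m. ?f j) - ?f 0"
    by (simp only: sum.lessThan_Suc_shift)
  also have "\<dots> = cos_sum m t"
    using assms by (simp add: cos_sum_def)
  finally show ?thesis .
qed

lemma cos_sum_shift:
  assumes "m > 0"
  shows "cos_sum m (t + of_int k * (pi / real m)) = cos_sum m t"
proof (induction k rule: int_induct[where k = 0])
  case (step1 i)
  then show ?case
    using cos_sum_shift_one[OF assms, of "t + of_int i * (pi / real m)"]
    by (simp add: algebra_simps add_divide_distrib)
next
  case (step2 i)
  then show ?case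
    using cos_sum_shift_one[OF assms, of "t + of_int (i - 1) * (pi / real m)"]
    by (simp add: algebra_simps add_divide_distrib diff_divide_distrib)
qed simp

text \<open>Multiplication by \<open>2 * sin h\<close> turns each cosine into a difference of sines
  half a step to either side, and these differences telescope.\<close>

lemma sum_cos_arithmetic:
  "(\<Sum>j<m. cos (t + 2 * h * real j)) * (2 * sin h) = sin (t + 2 * h * real m - h) - sin (t - h)"
proof (induction m)
  case (Suc m)
  have "2 * (cos (t + 2 * h * real m) * sin h) = sin (t + 2 * h * real m + h) - sin (t + 2 * h * real m - h)"
    by (simp add: sin_add sin_diff)
  then show ?case using Suc by (simp add: algebra_simps)
qed simp

text \<open>By \<open>cos_sum_shift\<close> all angles may be moved to \<open>[-\<pi>/2, \<pi>/2]\<close>, where the absolute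
  values can be dropped and the sum telescopes.\<close>

lemma cos_sum_bounds:
  assumes m: "m > 0"
  defines "h \<equiv> pi / (2 * real m)"
  shows "cos_sum m t \<le> 1 / sin h" and "cos h / sin h \<le> cos_sum m t"
proof -
  have h: "0 < h" "h \<le> pi / 2" using m by (auto simp: h_def field_simps)
  have hm: "pi = 2 * h * real m" "pi / real m = 2 * h" using m by (simp_all add: h_def)
  have sh: "sin h > 0" using h by (intro sin_gt_zero) auto
  \<comment> \<open>The least number of steps of length \<open>2 * h\<close> that brings the first
    angle to at least \<open>- (pi / 2)\<close>; the last one is then at most \<open>pi / 2\<close>,
    since \<open>m\<close> steps have total length \<open>pi\<close>.\<close>
  define k where "k = \<lceil>(- (pi / 2) - t) / (2 * h)\<rceil>"
  define s where "s = t + of_int k * (2 * h)"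
  have "(- (pi / 2) - t) / (2 * h) \<le> of_int k" "of_int k < (- (pi / 2) - t) / (2 * h) + 1"
    unfolding k_def by linarith+
  then have s: "- (pi / 2) \<le> s" "s \<le> - (pi / 2) + 2 * h"
    using h by (auto simp: s_def field_simps)
  have "cos (s + 2 * h * real j) \<ge> 0" if "j < m" for j
  proof (rule cos_ge_zero)
    have "2 * h * real j \<ge> 0" using h by simp
    then show "- (pi / 2) \<le> s + 2 * h * real j" using s by linarith
    have "2 * h * (real j + 1) \<le> 2 * h * real m"
      using that h by (intro mult_left_mono) auto
    then show "s + 2 * h * real j \<le> pi / 2" using s hm(1) by (simp add: distrib_left)
  qed
  then have "cos_sum m s = (\<Sum>j<m. cos (s + 2 * h * real j))"
    unfolding cos_sum_def by (intro sum.cong refl) (simp add: h_def)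
  then have "cos_sum m s * (2 * sin h) = sin (s - h + pi) - sin (s - h)"
    using sum_cos_arithmetic[of s h m] hm(1) by (simp add: algebra_simps)
  moreover have "cos_sum m s = cos_sum m t"
    unfolding s_def using cos_sum_shift[OF m, of t k] by (simp add: hm(2))
  ultimately have "cos_sum m t * (2 * sin h) = - sin (s - h) - sin (s - h)"
    by (simp only: sin_periodic_pi)
  \<comment> \<open>The sum is now known exactly. As \<open>s - h\<close> differs from
    \<open>- (pi / 2)\<close> by at most \<open>h\<close>, the right-hand side lies between
    \<open>cos h\<close> and 1.\<close>
  then have eq: "cos_sum m t * sin h = - sin (s - h)"
    by linarith
  have "- sin (s - h) \<le> 1" using sin_ge_minus_one[of "s - h"] by linarith
  with eq sh show "cos_sum m t \<le> 1 / sin h" by (simp add: field_simps)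
  have "cos h \<le> cos \<bar>s - h + pi / 2\<bar>"
    using s h by (intro cos_monotone_0_pi_le) auto
  also have "\<dots> = - sin (s - h)" by (simp add: cos_add)
  finally show "cos h / sin h \<le> cos_sum m t" using eq sh by (simp add: field_simps)
qed

lemma sum_lessThan_add:
  fixes f :: "nat \<Rightarrow> 'a :: ab_group_add"
  shows "sum f {..<m + n} = sum f {..<m} + (\<Sum>j<n. f (m + j))"
  by (induction n) (simp_all add: add.assoc)

text \<open>The full turn with \<open>2 * m\<close> points consists of two half-turns on which |cos|
  takes the same values.\<close>

lemma sum_abs_cos_double:
  assumes "m > 0"
  shows "(\<Sum>j<2 * m. \<bar>cos (t + 2 * pi * real j / real (2 * m))\<bar>) = 2 * cos_sum m t"
proof -
  let ?f = "\<lambda>j. \<bar>cos (t + pi * real j / real m)\<bar>"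
  have "(\<Sum>j<2 * m. \<bar>cos (t + 2 * pi * real j / real (2 * m))\<bar>) = sum ?f {..<m + m}"
    unfolding mult_2[of m, symmetric] by (rule sum.cong) simp_all
  also have "\<dots> = sum ?f {..<m} + (\<Sum>j<m. ?f (m + j))"
    by (rule sum_lessThan_add)
  also have "(\<Sum>j<m. ?f (m + j)) = sum ?f {..<m}"
  proof (rule sum.cong)
    fix j
    have "t + pi * real (m + j) / real m = t + pi * real j / real m + pi"
      using assms by (simp add: field_simps)
    then show "?f (m + j) = ?f j"
      by (simp only: cos_periodic_pi abs_minus_cancel flip: add.assoc)
  qed simp
  finally show ?thesis by (simp add: cos_sum_def)
qed

text \<open>The mean of 2|cos| over \<open>2 * m\<close> equally spaced angles is
  \<open>2 / real m * cos_sum m t\<close>; this is the limit of its upper bound, because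
  \<open>m * sin (pi / (2 * m))\<close> tends to \<open>pi / 2\<close>.\<close>

lemma upper_constant_tendsto: "(\<lambda>m. 2 / real m * (1 / sin (pi / (2 * real m)))) \<longlonglongrightarrow> 4 / pi"
  by real_asymp

text \<open>The additional factor \<open>(real m - 1) / real m\<close> is the weight that the Fejer
  mean gives to the frequencies 1 and -1.\<close>

lemma lower_constant_tendsto:
  "(\<lambda>m. (real m - 1) / real m * (2 / real m * (cos (pi / (2 * real m)) / sin (pi / (2 * real m))))) \<longlonglongrightarrow> 4 / pi"
  by real_asymp

text \<open>On the unit circle this is \<open>m\<close> times the usual Fejer kernel. The product
  form expands directly into monomials in \<open>v\<close> and \<open>cnj v\<close>.\<close>

definition fejer :: "nat \<Rightarrow> complex \<Rightarrow> complex" where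
  "fejer m v = (\<Sum>k<m. v ^ k) * cnj (\<Sum>k<m. v ^ k)"

lemma fejer_altdef: "fejer m v = complex_of_real ((cmod (\<Sum>k<m. v ^ k))\<^sup>2)"
  by (simp only: fejer_def complex_norm_square)

lemma fejer_sum: "fejer m (v * cnj w) = (\<Sum>(k, l)\<in>{..<m} \<times> {..<m}. (w ^ l * cnj w ^ k) * (v ^ k * cnj v ^ l))"
  by (simp add: fejer_def sum_product sum.cartesian_product power_mult_distrib ac_simps split_def)

text \<open>Only the \<open>m\<close> diagonal terms of the double sum survive orthogonality, and
  each contributes \<open>n\<close>. As the kernel is nonnegative, this is also its discrete
  L1-norm.\<close>

lemma sum_fejer:
  assumes "m \<le> n" "cmod v = 1"
  shows "(\<Sum>k<n. fejer m (v * cnj (root_of_unity n k))) = of_nat (n * m)"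
proof -
  have "(\<Sum>k<n. fejer m (v * cnj (root_of_unity n k))) =
      (\<Sum>(k, l)\<in>{..<m} \<times> {..<m}. (v ^ k * cnj v ^ l) * (\<Sum>j<n. root_of_unity n j ^ l * cnj (root_of_unity n j) ^ k))"
    unfolding fejer_sum by (subst sum.swap) (simp add: sum_distrib_left split_def ac_simps)
  also have "\<dots> = (\<Sum>k<m. \<Sum>l<m. (v ^ k * cnj v ^ l) * (if l = k then of_nat n else 0))"
    unfolding sum.cartesian_product[symmetric]
    using assms(1) by (intro sum.cong refl arg_cong2[where f = "(*)"] sum_root_of_unity) auto
  also have "\<dots> = (\<Sum>k<m. of_nat n)"
    using unimodular_mult_cnj[OF assms(2)] by (simp add: if_distrib cong: if_cong flip: power_mult_distrib)
  finally show ?thesis by simp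
qed

section \<open>Harmonic homogeneous polynomials in the plane\<close>

lemma partial_derivativeI:
  assumes "\<And>x. ((\<lambda>t. f (x + t *\<^sub>R axis i 1)) has_vector_derivative g x) (at 0)"
  shows "partial_derivative i f = g"
  unfolding partial_derivative_def using assms by (intro ext vector_derivative_at)

lemma has_vector_derivative_power_line:
  fixes w e :: complex
  shows "((\<lambda>t. (w + of_real t * e) ^ n) has_vector_derivative of_nat n * e * w ^ (n - 1)) (at 0)"
proof (rule has_vector_derivative_real_field[where f = "\<lambda>z. (w + z * e) ^ n"])
  show "((\<lambda>z. (w + z * e) ^ n) has_field_derivative of_nat n * e * w ^ (n - 1)) (at (complex_of_real 0))"
    by (rule derivative_eq_intros refl | simp)+
qed

text \<open>The exponents are arbitrary functions of the index, so that the family is closed under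
  both partial derivatives.\<close>

definition monomial_sum :: "nat set \<Rightarrow> (nat \<Rightarrow> complex) \<Rightarrow> (nat \<Rightarrow> nat) \<Rightarrow> (nat \<Rightarrow> nat) \<Rightarrow> real^2 \<Rightarrow> complex" where
  "monomial_sum A c a b x = (\<Sum>k\<in>A. c k * complex_of_real (x $ 1) ^ a k * complex_of_real (x $ 2) ^ b k)"

lemma partial_derivative_monomial_sum:
  "partial_derivative 1 (monomial_sum A c a b) = monomial_sum A (\<lambda>k. c k * of_nat (a k)) (\<lambda>k. a k - 1) b"
  "partial_derivative 2 (monomial_sum A c a b) = monomial_sum A (\<lambda>k. c k * of_nat (b k)) a (\<lambda>k. b k - 1)"
proof -
  let ?x = "\<lambda>x :: real^2. complex_of_real (x $ 1)" and ?y = "\<lambda>x :: real^2. complex_of_real (x $ 2)"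
  have "((\<lambda>t. \<Sum>k\<in>A. c k * (?x x + of_real t * 1) ^ a k * ?y x ^ b k) has_vector_derivative
      (\<Sum>k\<in>A. c k * (of_nat (a k) * 1 * ?x x ^ (a k - 1)) * ?y x ^ b k)) (at 0)" for x
    by (intro has_vector_derivative_sum has_vector_derivative_mult_left
        has_vector_derivative_mult_right has_vector_derivative_power_line)
  then show "partial_derivative 1 (monomial_sum A c a b) = monomial_sum A (\<lambda>k. c k * of_nat (a k)) (\<lambda>k. a k - 1) b"
    by (intro partial_derivativeI) (simp add: monomial_sum_def axis_def mult.assoc)
  have "((\<lambda>t. \<Sum>k\<in>A. c k * ?x x ^ a k * (?y x + of_real t * 1) ^ b k) has_vector_derivative
      (\<Sum>k\<in>A. c k * ?x x ^ a k * (of_nat (b k) * 1 * ?y x ^ (b k - 1)))) (at 0)" for x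
    by (intro has_vector_derivative_sum has_vector_derivative_mult_left
        has_vector_derivative_mult_right has_vector_derivative_power_line)
  then show "partial_derivative 2 (monomial_sum A c a b) = monomial_sum A (\<lambda>k. c k * of_nat (b k)) a (\<lambda>k. b k - 1)"
    by (intro partial_derivativeI) (simp add: monomial_sum_def axis_def ac_simps)
qed

text \<open>The coefficient of \<open>x ^ k * y ^ (d - k - 2)\<close> in the Laplacian. For
  \<open>k = d - 1\<close> and \<open>k = d\<close> both summands vanish, so the truncated exponent
  does no harm.\<close>

definition laplacian_coeffs :: "nat \<Rightarrow> (nat \<Rightarrow> complex) \<Rightarrow> nat \<Rightarrow> complex" where
  "laplacian_coeffs d c k = (if k + 2 \<le> d then c (k + 2) * of_nat (k + 2) * of_nat (k + 1) else 0)
     + c k * of_nat (d - k) * of_nat (d - k - 1)"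

lemma laplacian_monomial_sum:
  "laplacian (monomial_sum {..d} c (\<lambda>k. k) (\<lambda>k. d - k)) x =
     (\<Sum>k\<le>d. laplacian_coeffs d c k * complex_of_real (x $ 1) ^ k * complex_of_real (x $ 2) ^ (d - k - 2))"
proof -
  let ?x = "complex_of_real (x $ 1)" and ?y = "complex_of_real (x $ 2)"
  define f where "f k = (if k \<le> d then c k * of_nat k * of_nat (k - 1) * ?x ^ (k - 2) * ?y ^ (d - k) else 0)" for k
  have "laplacian (monomial_sum {..d} c (\<lambda>k. k) (\<lambda>k. d - k)) x =
      (\<Sum>k\<le>d. f k) + (\<Sum>k\<le>d. c k * of_nat (d - k) * of_nat (d - k - 1) * ?x ^ k * ?y ^ (d - k - 2))"
    by (simp add: laplacian_def sum_2 partial_derivative_monomial_sum) (simp add: monomial_sum_def f_def numeral_2_eq_2)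
  \<comment> \<open>\<open>f\<close> vanishes at \<open>d + 1\<close> and \<open>d + 2\<close> by
    its conditional, and at 0 and 1 by the factor \<open>k * (k - 1)\<close>, so the index can be
    shifted by two.\<close>
  also have "(\<Sum>k\<le>d. f k) = (\<Sum>k\<le>Suc (Suc d). f k)"
    by (simp add: f_def)
  also have "\<dots> = (\<Sum>k\<le>d. f (Suc (Suc k)))"
    by (simp only: sum.atMost_Suc_shift) (simp add: f_def)
  also have "\<dots> = (\<Sum>k\<le>d. (if k + 2 \<le> d then c (k + 2) * of_nat (k + 2) * of_nat (k + 1) else 0) * ?x ^ k * ?y ^ (d - k - 2))"
    by (intro sum.cong refl) (simp add: f_def)
  finally show ?thesis
    by (simp only: laplacian_coeffs_def distrib_right sum.distrib)
qed

text \<open>On the line \<open>y = 1\<close> the Laplacian is a polynomial in one variable that has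
  every real number as a root.\<close>

lemma laplacian_coeffs_eq_0:
  assumes "\<And>x. laplacian (monomial_sum {..d} c (\<lambda>k. k) (\<lambda>k. d - k)) x = 0" "k \<le> d"
  shows "laplacian_coeffs d c k = 0"
proof (rule ccontr)
  assume "laplacian_coeffs d c k \<noteq> 0"
  then have "finite {z. (\<Sum>j\<le>d. laplacian_coeffs d c j * z ^ j) = 0}"
    using polyfun_roots_finite assms(2) by blast
  moreover have "range complex_of_real \<subseteq> {z. (\<Sum>j\<le>d. laplacian_coeffs d c j * z ^ j) = 0}"
  proof safe
    fix t :: real
    show "(\<Sum>j\<le>d. laplacian_coeffs d c j * complex_of_real t ^ j) = 0"
      using assms(1)[of "\<chi> i. if i = 1 then t else 1"] by (simp add: laplacian_monomial_sum)
  qed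
  ultimately have "finite (range complex_of_real)" by (rule finite_subset[rotated])
  then show False
    by (simp add: finite_image_iff inj_on_def infinite_UNIV_char_0)
qed

lemma laplacian_coeffs_linear:
  "laplacian_coeffs d (\<lambda>k. c k - (p * a k + q * b k)) k =
     laplacian_coeffs d c k - (p * laplacian_coeffs d a k + q * laplacian_coeffs d b k)"
  by (simp add: laplacian_coeffs_def algebra_simps)

text \<open>The equations express \<open>c (k + 2)\<close> through \<open>c k\<close>. Harmonicity
  thus leaves at most two free parameters, \<open>c 0\<close> and \<open>c 1\<close>.\<close>

lemma laplacian_coeffs_kernel:
  assumes lap: "\<And>k. k \<le> d \<Longrightarrow> laplacian_coeffs d c k = 0" and "c 0 = 0" "c 1 = 0" and "k \<le> d"
  shows "c k = 0"
  using \<open>k \<le> d\<close>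
proof (induction k rule: less_induct)
  case (less k)
  show ?case
  proof (cases "k < 2")
    case True
    then show ?thesis using assms(2,3) by (auto simp: less_2_cases_iff)
  next
    case False
    then obtain j where j: "k = j + 2" by (metis add.commute le_Suc_ex not_less)
    have "c j = 0" using less j by auto
    then have "c (j + 2) * of_nat (j + 2) * of_nat (j + 1) = 0"
      using lap[of j] less.prems j by (simp add: laplacian_coeffs_def)
    then show ?thesis unfolding j mult_eq_0_iff of_nat_eq_0_iff by simp
  qed
qed

lemma power_linear_form:
  "(complex_of_real (x $ 1) + e * complex_of_real (x $ 2)) ^ d =
     monomial_sum {..d} (\<lambda>k. of_nat (d choose k) * e ^ (d - k)) (\<lambda>k. k) (\<lambda>k. d - k) x"
  by (simp add: binomial_ring monomial_sum_def power_mult_distrib ac_simps)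

text \<open>The two second derivatives of a power of \<open>x + e * y\<close> differ by the factor
  \<open>e\<^sup>2\<close>, so they cancel.\<close>

lemma laplacian_power_linear_form:
  assumes "e\<^sup>2 = -1"
  shows "laplacian (\<lambda>x. (complex_of_real (x $ 1) + e * complex_of_real (x $ 2)) ^ d) x = 0"
proof -
  let ?w = "\<lambda>x :: real^2. complex_of_real (x $ 1) + e * complex_of_real (x $ 2)"
  have "((\<lambda>t. c * (?w x + of_real t * e') ^ n) has_vector_derivative c * (of_nat n * e' * ?w x ^ (n - 1))) (at 0)"
    for c e' n x
    by (intro has_vector_derivative_mult_right has_vector_derivative_power_line)
  from this[of _ _ 1] this[of _ _ e]
  have 1: "partial_derivative 1 (\<lambda>x. c * ?w x ^ n) = (\<lambda>x. (c * of_nat n) * ?w x ^ (n - 1))"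
    and 2: "partial_derivative 2 (\<lambda>x. c * ?w x ^ n) = (\<lambda>x. (c * of_nat n * e) * ?w x ^ (n - 1))" for c n
    by (intro partial_derivativeI; simp add: axis_def algebra_simps)+
  have "laplacian (\<lambda>x. 1 * ?w x ^ d) x =
      of_nat d * of_nat (d - 1) * ?w x ^ (d - 1 - 1) + of_nat d * of_nat (d - 1) * ?w x ^ (d - 1 - 1) * e\<^sup>2"
    unfolding laplacian_def sum_2 1 2 by (simp add: power2_eq_square algebra_simps)
  then show ?thesis using assms by simp
qed

section \<open>Circular harmonics as the span of a power and its conjugate\<close>

definition circle_power :: "nat \<Rightarrow> real^2 \<Rightarrow> complex" where
  "circle_power d x = Complex (x $ 1) (x $ 2) ^ d"

lemma circle_power_altdef:
  "circle_power d x = (complex_of_real (x $ 1) + \<i> * complex_of_real (x $ 2)) ^ d"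
  "cnj (circle_power d x) = (complex_of_real (x $ 1) + (-\<i>) * complex_of_real (x $ 2)) ^ d"
  by (simp_all add: circle_power_def Complex_eq)

lemma carrier_circular_harmonics:
  assumes d: "d \<ge> 1"
  shows "carrier (circular_harmonics d) =
    {\<lambda>x\<in>unit_circle. a * circle_power d x + b * cnj (circle_power d x) | a b. True}"
    (is "_ = ?R")
proof -
  let ?p = "\<lambda>c. monomial_sum {..d} c (\<lambda>k. k) (\<lambda>k. d - k)"
  define u where "u = (\<lambda>e k. of_nat (d choose k) * e ^ (d - k) :: complex)"
  have cp: "circle_power d = ?p (u \<i>)" "(\<lambda>x. cnj (circle_power d x)) = ?p (u (-\<i>))"
    unfolding circle_power_altdef(2) unfolding circle_power_altdef(1) power_linear_form u_def
    by (intro ext refl)+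
  have lap: "laplacian (?p (u \<i>)) x = 0" "laplacian (?p (u (-\<i>))) x = 0" for x
    using laplacian_power_linear_form[of \<i> d x] laplacian_power_linear_form[of "-\<i>" d x]
    unfolding power_linear_form u_def by simp_all
  note lapc = laplacian_coeffs_eq_0[OF lap(1)] laplacian_coeffs_eq_0[OF lap(2)]
  have lin: "?p (\<lambda>k. a * u \<i> k + b * u (-\<i>) k) x = a * circle_power d x + b * cnj (circle_power d x)" for a b x
    using fun_cong[OF cp(1), of x] fun_cong[OF cp(2), of x]
    by (simp add: monomial_sum_def sum_distrib_left sum.distrib algebra_simps)
  have carr: "carrier (circular_harmonics d) =
      {restrict (?p c) unit_circle | c. \<forall>x. laplacian (?p c) x = 0}"
    unfolding circular_harmonics_def homogeneous_polynomials_def monomial_sum_def by auto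
  show ?thesis
  proof (intro equalityI subsetI)
    fix f assume "f \<in> carrier (circular_harmonics d)"
    then obtain c where c: "f = restrict (?p c) unit_circle" "\<And>x. laplacian (?p c) x = 0"
      unfolding carr by blast
    define a b where "a = (c 0 + \<i> * c 1 / of_nat d) / 2 * (-\<i>) ^ d"
      and "b = (c 0 - \<i> * c 1 / of_nat d) / 2 * \<i> ^ d"
    \<comment> \<open>\<open>a\<close> and \<open>b\<close> are chosen such that \<open>r 0 = r 1 = 0\<close>, which by the recursion forces \<open>r = 0\<close>\<close>
    define r where "r k = c k - (a * u \<i> k + b * u (-\<i>) k)" for k
    obtain n where n: "d = Suc n" using d by (cases d) auto
    have ii: "(-\<i>) ^ k * \<i> ^ k = 1" "\<i> ^ k * (-\<i>) ^ k = 1" for k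
      by (simp_all flip: power_mult_distrib)
    \<comment> \<open>With \<alpha> = \<open>a * \<i> ^ d\<close> and \<beta> =
      \<open>b * (-\<i>) ^ d\<close> the conditions read \<alpha> + \<beta> = \<open>c 0\<close> and
      - \<i> \<alpha> + \<i> \<beta> = \<open>c 1 / d\<close>; these values are the
      solution.\<close>
    have "a * \<i> ^ d = (c 0 + \<i> * c 1 / of_nat d) / 2" "b * (-\<i>) ^ d = (c 0 - \<i> * c 1 / of_nat d) / 2"
      unfolding a_def b_def mult.assoc ii by simp_all
    moreover have "a * \<i> ^ n = - \<i> * (a * \<i> ^ d)" "b * (-\<i>) ^ n = \<i> * (b * (-\<i>) ^ d)"
      by (simp_all add: n mult.left_commute[of a] mult.left_commute[of b])
    ultimately have "a * \<i> ^ d = (c 0 + \<i> * c 1 / of_nat d) / 2" "b * (-\<i>) ^ d = (c 0 - \<i> * c 1 / of_nat d) / 2"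
        "a * \<i> ^ n = - \<i> * ((c 0 + \<i> * c 1 / of_nat d) / 2)"
        "b * (-\<i>) ^ n = \<i> * ((c 0 - \<i> * c 1 / of_nat d) / 2)"
      by (simp_all only:)
    note E = this
    have "r 0 = c 0 - (a * \<i> ^ d + b * (-\<i>) ^ d)"
      by (simp add: r_def u_def)
    then have "r 0 = 0"
      unfolding E(1,2) by (simp add: field_simps)
    moreover have "r 1 = c 1 - of_nat d * (a * \<i> ^ n + b * (-\<i>) ^ n)"
      by (simp add: r_def u_def n distrib_left mult.left_commute)
    then have "r 1 = 0"
      unfolding E(3,4) using d by (simp add: field_simps)
    moreover have "laplacian_coeffs d r k = 0" if "k \<le> d" for k
      unfolding r_def laplacian_coeffs_linear
      using laplacian_coeffs_eq_0[OF c(2) that] lapc[OF that] by simp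
    ultimately have "r k = 0" if "k \<le> d" for k
      using laplacian_coeffs_kernel that by blast
    then have eq: "?p c x = ?p (\<lambda>k. a * u \<i> k + b * u (-\<i>) k) x" for x
      unfolding monomial_sum_def by (intro sum.cong) (auto simp: r_def)
    have "restrict (?p c) unit_circle =
        (\<lambda>x\<in>unit_circle. a * circle_power d x + b * cnj (circle_power d x))"
      by (rule restrict_ext) (simp only: eq lin)
    then show "f \<in> ?R"
      unfolding c(1) by blast
  next
    fix f assume "f \<in> ?R"
    then obtain a b where f: "f = (\<lambda>x\<in>unit_circle. a * circle_power d x + b * cnj (circle_power d x))"
      by blast
    let ?c = "\<lambda>k. a * u \<i> k + b * u (-\<i>) k"
    \<comment> \<open>The sum is written as a difference with negated coefficients to fit
      \<open>laplacian_coeffs_linear\<close>.\<close>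
    have "laplacian_coeffs d (\<lambda>k. 0 - ((-a) * u \<i> k + (-b) * u (-\<i>) k)) k = 0" if "k \<le> d" for k
      unfolding laplacian_coeffs_linear using lapc[OF that] by (simp add: laplacian_coeffs_def)
    then have "laplacian_coeffs d ?c k = 0" if "k \<le> d" for k
      using that by (simp add: add.commute)
    then have "laplacian (?p ?c) x = 0" for x
      by (simp add: laplacian_monomial_sum)
    then show "f \<in> carrier (circular_harmonics d)"
      unfolding carr f lin[symmetric] by blast
  qed
qed

section \<open>Upper bound\<close>

lemma norm_circle_power: "x \<in> unit_circle \<Longrightarrow> cmod (circle_power d x) = 1"
  by (simp add: circle_power_def norm_power norm_vec_def L2_set_def sum_2 complex_norm)

text \<open>The point at angle \<open>Arg v / d\<close> is a preimage. This lifts roots of unity to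
  points at which harmonics can be evaluated.\<close>

lemma circle_power_surj:
  assumes "d \<ge> 1" "cmod v = 1"
  shows "\<exists>x\<in>unit_circle. circle_power d x = v"
proof
  define t where "t = Arg v / real d"
  define x :: "real^2" where "x = (\<chi> i. if i = 1 then cos t else sin t)"
  show "x \<in> unit_circle"
    by (simp add: x_def norm_vec_def L2_set_def sum_2)
  have "circle_power d x = cis t ^ d"
    by (simp add: circle_power_def x_def cis.ctr)
  also have "\<dots> = cis (Arg v)"
    using assms(1) by (simp add: Complex.DeMoivre t_def)
  also have "\<dots> = v"
    using assms(2) by (subst cis_Arg) (auto simp: sgn_eq)
  finally show "circle_power d x = v" .
qed

lemma unit_circle_nonempty: "unit_circle \<noteq> {}"
  using circle_power_surj[of 1 1] by auto

definition harmonic :: "nat \<Rightarrow> complex \<Rightarrow> complex \<Rightarrow> real^2 \<Rightarrow> complex" where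
  "harmonic d a b = (\<lambda>x\<in>unit_circle. a * circle_power d x + b * cnj (circle_power d x))"

lemma harmonic_extensional [simp]: "harmonic d a b \<in> extensional unit_circle"
  by (simp only: harmonic_def restrict_extensional)

lemma carrier_circular_harmonics_harmonic:
  "d \<ge> 1 \<Longrightarrow> carrier (circular_harmonics d) = {harmonic d a b | a b. True}"
  by (simp add: carrier_circular_harmonics harmonic_def)

lemma circular_harmonics_simps [simp]:
  "zero (circular_harmonics d) = (\<lambda>x\<in>unit_circle. 0)"
  "add (circular_harmonics d) = (\<lambda>f g. \<lambda>x\<in>unit_circle. f x + g x)"
  "smult (circular_harmonics d) = (\<lambda>a f. \<lambda>x\<in>unit_circle. a * f x)"
  "vnorm (circular_harmonics d) = (\<lambda>f. SUP x\<in>unit_circle. cmod (f x))"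
  by (simp_all add: circular_harmonics_def)

lemma harmonic_linear:
  "harmonic d a b \<oplus>\<^bsub>circular_harmonics d\<^esub> harmonic d a' b' = harmonic d (a + a') (b + b')"
  "c \<odot>\<^bsub>circular_harmonics d\<^esub> harmonic d a b = harmonic d (c * a) (c * b)"
  "\<zero>\<^bsub>circular_harmonics d\<^esub> = harmonic d 0 0"
  by (auto simp: harmonic_def algebra_simps)

lemma bdd_above_harmonic: "bdd_above ((\<lambda>x. cmod (harmonic d a b x)) ` unit_circle)"
proof (rule bdd_aboveI2)
  fix x assume "x \<in> unit_circle"
  then show "cmod (harmonic d a b x) \<le> cmod a + cmod b"
    using norm_triangle_ineq[of "a * circle_power d x" "b * cnj (circle_power d x)"]
    by (simp add: harmonic_def norm_mult norm_circle_power del: mem_sphere_0)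
qed

lemma norm_harmonic_le:
  "x \<in> unit_circle \<Longrightarrow> cmod (harmonic d a b x) \<le> vnorm (circular_harmonics d) (harmonic d a b)"
  unfolding circular_harmonics_simps by (rule cSUP_upper[OF _ bdd_above_harmonic])

text \<open>Discrete Fourier coefficients recover \<open>a\<close> and \<open>b\<close>: the cross
  terms have frequency 2 or -2, which is nonzero modulo \<open>n\<close> for
  \<open>n \<ge> 3\<close>.\<close>

lemma sum_root_of_unity_harmonic:
  assumes "n \<ge> 3"
  shows "(\<Sum>k<n. (a * root_of_unity n k + b * cnj (root_of_unity n k)) * cnj (root_of_unity n k)) = of_nat n * a"
    and "(\<Sum>k<n. (a * root_of_unity n k + b * cnj (root_of_unity n k)) * root_of_unity n k) = of_nat n * b"
proof -
  let ?w = "root_of_unity n"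
  have "(\<Sum>k<n. (a * ?w k + b * cnj (?w k)) * cnj (?w k)) =
      a * (\<Sum>k<n. ?w k ^ 1 * cnj (?w k) ^ 1) + b * (\<Sum>k<n. ?w k ^ 0 * cnj (?w k) ^ 2)"
    by (simp add: sum_distrib_left power2_eq_square distrib_right sum.distrib mult.assoc)
  then show "(\<Sum>k<n. (a * ?w k + b * cnj (?w k)) * cnj (?w k)) = of_nat n * a"
    using assms by (subst (asm) (1 2) sum_root_of_unity) auto
  have "(\<Sum>k<n. (a * ?w k + b * cnj (?w k)) * ?w k) =
      a * (\<Sum>k<n. ?w k ^ 2 * cnj (?w k) ^ 0) + b * (\<Sum>k<n. ?w k ^ 1 * cnj (?w k) ^ 1)"
    by (simp add: sum_distrib_left power2_eq_square distrib_right sum.distrib mult.assoc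
        mult.commute[of "cnj (?w k)" "?w k" for k])
  then show "(\<Sum>k<n. (a * ?w k + b * cnj (?w k)) * ?w k) = of_nat n * b"
    using assms by (subst (asm) (1 2) sum_root_of_unity) auto
qed

text \<open>There are \<open>n = 2 * m\<close> nodes: an even number, so that they split into the
  half-turns of \<open>cos_sum\<close>, and at least three, so that the discrete coefficients
  reproduce harmonics.\<close>

lemma relative_projection_constant_le:
  assumes Y: "complex_banach_space Y" and I: "I \<in> isometric_embeddings (circular_harmonics d) Y"
    and d: "d \<ge> 1" and m: "m \<ge> 2"
  shows "relative_projection_constant (I ` carrier (circular_harmonics d)) Y
    \<le> ereal (2 / real m * (1 / sin (pi / (2 * real m))))"
proof -
  interpret Y: complex_banach_space Y by (rule Y)
  let ?H = "circular_harmonics d"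
  note H = carrier_circular_harmonics_harmonic[OF d]
  define K where "K = 2 / real m * (1 / sin (pi / (2 * real m)))"
  define n where "n = 2 * m"
  define w where "w = root_of_unity n"
  have Iin: "I (harmonic d a b) \<in> carrier Y" for a b
    using I by (auto simp: isometric_embeddings_def linear_operators_def H)
  have hin: "harmonic d a b \<in> carrier ?H" for a b
    unfolding H by blast
  have Iadd: "I (harmonic d a b) \<oplus>\<^bsub>Y\<^esub> I (harmonic d a' b') = I (harmonic d (a + a') (b + b'))" for a b a' b'
  proof -
    have "\<forall>x\<in>carrier ?H. \<forall>y\<in>carrier ?H. I (x \<oplus>\<^bsub>?H\<^esub> y) = I x \<oplus>\<^bsub>Y\<^esub> I y"
      using I unfolding isometric_embeddings_def linear_operators_def by blast
    from this[rule_format, OF hin hin] show ?thesis by (simp only: harmonic_linear)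
  qed
  have Ismult: "c \<odot>\<^bsub>Y\<^esub> I (harmonic d a b) = I (harmonic d (c * a) (c * b))" for c a b
  proof -
    have "\<forall>a. \<forall>x\<in>carrier ?H. I (a \<odot>\<^bsub>?H\<^esub> x) = a \<odot>\<^bsub>Y\<^esub> I x"
      using I unfolding isometric_embeddings_def linear_operators_def by blast
    from this[rule_format, OF hin] show ?thesis by (simp only: harmonic_linear)
  qed
  have Inorm: "vnorm Y (I (harmonic d a b)) = vnorm ?H (harmonic d a b)" for a b
    using I unfolding isometric_embeddings_def H by blast
  have Izero: "I (harmonic d 0 0) = \<zero>\<^bsub>Y\<^esub>"
    using Ismult[of 0 0 0] Y.smult_complex(6)[OF Iin] by simp
  have "\<exists>x\<in>unit_circle. circle_power d x = w k" for k
    using circle_power_surj[OF d] by (simp add: w_def)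
  then obtain pt where pt: "\<And>k. pt k \<in> unit_circle" "\<And>k. circle_power d (pt k) = w k"
    by metis
  \<comment> \<open>All that is required of an extension \<open>F\<close> of the evaluation at the
    node \<open>pt k\<close>, bundled so that the functionals can be chosen for all \<open>k\<close>
    at once.\<close>
  define Q where "Q k F \<longleftrightarrow>
      (\<forall>x\<in>carrier Y. \<forall>y\<in>carrier Y. F (x \<oplus>\<^bsub>Y\<^esub> y) = F x + F y) \<and>
      (\<forall>c. \<forall>x\<in>carrier Y. F (c \<odot>\<^bsub>Y\<^esub> x) = c * F x) \<and>
      (\<forall>x\<in>carrier Y. cmod (F x) \<le> vnorm Y x) \<and>
      (\<forall>a b. F (I (harmonic d a b)) = a * w k + b * cnj (w k))" for k :: nat and F
  have "\<exists>F. Q k F" for k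
  proof -
    define G where "G = {(I (harmonic d a b), a * w k + b * cnj (w k)) | a b. True}"
    have GI: "(y, c) \<in> G" if "y = I (harmonic d a b)" "c = a * w k + b * cnj (w k)" for y c a b
      using that unfolding G_def by blast
    have GE: "\<exists>a b. y = I (harmonic d a b) \<and> c = a * w k + b * cnj (w k)" if "(y, c) \<in> G" for y c
      using that unfolding G_def by blast
    obtain F where "\<And>x y. x \<in> carrier Y \<Longrightarrow> y \<in> carrier Y \<Longrightarrow> F (x \<oplus>\<^bsub>Y\<^esub> y) = F x + F y"
      "\<And>c x. x \<in> carrier Y \<Longrightarrow> F (c \<odot>\<^bsub>Y\<^esub> x) = c * F x"
      "\<And>x. x \<in> carrier Y \<Longrightarrow> cmod (F x) \<le> vnorm Y x"
      "\<And>x a. (x, a) \<in> G \<Longrightarrow> F x = a"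
    proof (rule Y.hahn_banach[of G])
      show "G \<subseteq> carrier Y \<times> UNIV" unfolding G_def using Iin by auto
      show "(\<zero>\<^bsub>Y\<^esub>, 0) \<in> G" by (rule GI[of _ 0 0]) (simp_all add: Izero)
      show "(x \<oplus>\<^bsub>Y\<^esub> y, a + b) \<in> G" if xy: "(x, a) \<in> G" "(y, b) \<in> G" for x a y b
      proof -
        obtain p q p' q' where "x = I (harmonic d p q)" "a = p * w k + q * cnj (w k)"
          "y = I (harmonic d p' q')" "b = p' * w k + q' * cnj (w k)"
          using GE[OF xy(1)] GE[OF xy(2)] by (elim exE conjE)
        then show ?thesis
          by (intro GI[of _ "p + p'" "q + q'"]) (simp_all add: Iadd algebra_simps)
      qed
      show "(c \<odot>\<^bsub>Y\<^esub> x, c * a) \<in> G" if xa: "(x, a) \<in> G" for c x a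
      proof -
        obtain p q where "x = I (harmonic d p q)" "a = p * w k + q * cnj (w k)"
          using GE[OF xa] by (elim exE conjE)
        then show ?thesis
          by (intro GI[of _ "c * p" "c * q"]) (simp_all add: Ismult algebra_simps)
      qed
      show "cmod a \<le> vnorm Y x" if xa: "(x, a) \<in> G" for x a
      proof -
        obtain p q where x: "x = I (harmonic d p q)" and a: "a = p * w k + q * cnj (w k)"
          using GE[OF xa] by (elim exE conjE)
        \<comment> \<open>The prescribed value is that of the harmonic at \<open>pt k\<close>, hence
          bounded by its sup norm, which \<open>I\<close> preserves.\<close>
        have "a = harmonic d p q (pt k)"
          unfolding a harmonic_def restrict_apply'[OF pt(1)] pt(2) ..
        then show ?thesis
          unfolding x Inorm by (simp only: norm_harmonic_le[OF pt(1)])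
      qed
    qed (rule that)
    then have "Q k F" unfolding Q_def by (simp add: GI)
    then show ?thesis by (rule exI[of "Q k" F])
  qed
  then obtain F where F: "\<And>k. Q k (F k)"
    by metis
  have F_add: "F k (x \<oplus>\<^bsub>Y\<^esub> y) = F k x + F k y" if "x \<in> carrier Y" "y \<in> carrier Y" for k x y
    using F[of k] that unfolding Q_def by blast
  have F_smult: "F k (c \<odot>\<^bsub>Y\<^esub> x) = c * F k x" if "x \<in> carrier Y" for k c x
    using F[of k] that unfolding Q_def by blast
  have F_le: "cmod (F k x) \<le> vnorm Y x" if "x \<in> carrier Y" for k x
    using F[of k] that unfolding Q_def by blast
  have F_I: "F k (I (harmonic d a b)) = a * w k + b * cnj (w k)" for k a b
    using F[of k] unfolding Q_def by blast
  \<comment> \<open>Discrete Fourier coefficients with the functionals \<open>F k\<close> in place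
    of function values.\<close>
  define A B where "A y = (\<Sum>k<n. F k y * cnj (w k)) / of_nat n"
    and "B y = (\<Sum>k<n. F k y * w k) / of_nat n" for y
  define P where "P y = I (harmonic d (A y) (B y))" for y
  have P_norm: "vnorm Y (P y) \<le> K * vnorm Y y" if y: "y \<in> carrier Y" for y
  proof -
    have "cmod (harmonic d (A y) (B y) x) \<le> K * vnorm Y y" if x: "x \<in> unit_circle" for x
    proof -
      let ?u = "circle_power d x"
      define t where "t = Arg ?u"
      have "?u = cis t"
        using norm_circle_power[OF x, of d] unfolding t_def by (subst cis_Arg) (auto simp: sgn_eq)
      then have "w k * cnj ?u = cis (- t + 2 * pi * real k / real n)" for k
        by (simp add: w_def root_of_unity_def cis_cnj cis_mult add.commute)
      moreover have "cnj (w k) * ?u = cnj (w k * cnj ?u)" for k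
        by simp
      ultimately have "cnj (w k) * ?u + w k * cnj ?u = of_real (2 * cos (- t + 2 * pi * real k / real n))" for k
        by (simp only:) (simp add: complex_eq_iff)
      \<comment> \<open>The two conjugate terms combine to a real weight, the kernel 2 Re at the
        rotation between the node and the value of \<open>circle_power d\<close> at
        \<open>x\<close>.\<close>
      then have split: "F k y * cnj (w k) * ?u + F k y * w k * cnj ?u =
          F k y * of_real (2 * cos (- t + 2 * pi * real k / real n))" for k
        by (simp only: mult.assoc distrib_left[symmetric])
      have "harmonic d (A y) (B y) x = (\<Sum>k<n. F k y * cnj (w k) * ?u + F k y * w k * cnj ?u) / of_nat n"
        using x unfolding harmonic_def A_def B_def
        by (simp add: sum.distrib sum_distrib_right add_divide_distrib del: mem_sphere_0)
      also have "cmod \<dots> \<le> (\<Sum>k<n. cmod (F k y) * (2 * \<bar>cos (- t + 2 * pi * real k / real n)\<bar>)) / real n"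
        unfolding split norm_divide norm_of_nat
        by (intro divide_right_mono order_trans[OF norm_sum]) (auto simp: norm_mult abs_mult)
      also have "\<dots> \<le> (\<Sum>k<n. vnorm Y y * (2 * \<bar>cos (- t + 2 * pi * real k / real n)\<bar>)) / real n"
        by (intro divide_right_mono sum_mono mult_right_mono F_le y) auto
      also have "\<dots> = vnorm Y y * (2 * (2 * cos_sum m (- t))) / real n"
        using m by (simp only: n_def sum_abs_cos_double sum_distrib_left[symmetric])
      also have "\<dots> = 2 / real m * cos_sum m (- t) * vnorm Y y"
        by (simp add: n_def)
      \<comment> \<open>The bound for \<open>cos_sum\<close> does not depend on the shift, so the
        estimate is uniform in \<open>x\<close>. \<open>F_le\<close> also supplies nonnegativity of
        the norm.\<close>
      also have "\<dots> \<le> K * vnorm Y y"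
        unfolding K_def using m order_trans[OF norm_ge_zero F_le[OF y, of 0]]
        by (intro mult_right_mono mult_left_mono cos_sum_bounds) auto
      finally show ?thesis .
    qed
    then show ?thesis
      unfolding P_def Inorm circular_harmonics_simps by (intro cSUP_least unit_circle_nonempty)
  qed
  have P_proj: "P (I (harmonic d a b)) = I (harmonic d a b)" for a b
    using sum_root_of_unity_harmonic[of n a b] m
    by (simp add: P_def A_def B_def F_I w_def n_def)
  have P_bounded: "P \<in> bounded_operators Y (Y\<lparr>carrier := I ` carrier ?H\<rparr>)"
    unfolding bounded_operators_def linear_operators_def
  proof (intro CollectI conjI ballI allI Pi_I exI)
    show "P y \<in> carrier (Y\<lparr>carrier := I ` carrier ?H\<rparr>)" for y
      unfolding P_def H by auto
    show "P (x \<oplus>\<^bsub>Y\<^esub> y) = P x \<oplus>\<^bsub>Y\<lparr>carrier := I ` carrier ?H\<rparr>\<^esub> P y"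
      if "x \<in> carrier Y" "y \<in> carrier Y" for x y
      using that by (simp add: P_def Iadd A_def B_def F_add distrib_right sum.distrib add_divide_distrib)
    show "P (a \<odot>\<^bsub>Y\<^esub> x) = a \<odot>\<^bsub>Y\<lparr>carrier := I ` carrier ?H\<rparr>\<^esub> P x" if "x \<in> carrier Y" for a x
      using that by (simp add: P_def Ismult A_def B_def F_smult mult.assoc flip: sum_distrib_left)
    show "vnorm (Y\<lparr>carrier := I ` carrier ?H\<rparr>) (P x) \<le> K * vnorm Y x" if "x \<in> carrier Y" for x
      using P_norm[OF that] by simp
  qed
  have "operator_norm Y (Y\<lparr>carrier := I ` carrier ?H\<rparr>) P \<le> K"
    unfolding operator_norm_def
  proof (rule cSUP_least)
    show "{x \<in> carrier Y. vnorm Y x \<le> 1} \<noteq> {}"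
      by (auto intro!: exI[of _ "\<zero>\<^bsub>Y\<^esub>"])
    fix x assume x: "x \<in> {x \<in> carrier Y. vnorm Y x \<le> 1}"
    have "pi / (2 * real m) < pi" using m by (simp add: field_simps)
    then have "0 \<le> K" using m by (simp add: K_def sin_ge_zero)
    then have "K * vnorm Y x \<le> K * 1" using x by (intro mult_left_mono) auto
    with P_norm[of x] x show "vnorm (Y\<lparr>carrier := I ` carrier ?H\<rparr>) (P x) \<le> K" by simp
  qed
  moreover have "relative_projection_constant (I ` carrier ?H) Y
      \<le> ereal (operator_norm Y (Y\<lparr>carrier := I ` carrier ?H\<rparr>) P)"
    unfolding relative_projection_constant_def
    using P_bounded P_proj by (intro INF_lower) (auto simp: H)
  ultimately show ?thesis
    unfolding K_def by (meson ereal_less_eq(3) order_trans)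
qed

lemma relative_projection_constant_le_4_pi:
  assumes "complex_banach_space Y" "I \<in> isometric_embeddings (circular_harmonics d) Y" "d \<ge> 1"
  shows "relative_projection_constant (I ` carrier (circular_harmonics d)) Y \<le> ereal (4 / pi)"
proof (rule LIMSEQ_le_const)
  show "(\<lambda>m. ereal (2 / real m * (1 / sin (pi / (2 * real m))))) \<longlonglongrightarrow> ereal (4 / pi)"
    using upper_constant_tendsto by simp
  show "\<exists>N. \<forall>m\<ge>N. relative_projection_constant (I ` carrier (circular_harmonics d)) Y
      \<le> ereal (2 / real m * (1 / sin (pi / (2 * real m))))"
    using relative_projection_constant_le[OF assms] by blast
qed

section \<open>The Banach space of bounded functions\<close>

text \<open>
  \<open>Metric_space\<close> demands that distances be nonnegative and symmetric on the whole type, also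
  outside the carrier. The operations below therefore first replace every element of the type
  that is not a bounded function by \<open>0\<close>.
\<close>

definition bounded_part :: "'x set \<Rightarrow> ('x \<Rightarrow> complex) + 'y \<Rightarrow> 'x \<Rightarrow> complex" where
  "bounded_part S y = (\<lambda>x\<in>S. case y of Inl f \<Rightarrow> if bounded (f ` S) then f x else 0 | Inr _ \<Rightarrow> 0)"

definition bounded_functions :: "'x set \<Rightarrow> (('x \<Rightarrow> complex) + 'y) normed_module" where
  "bounded_functions S =
     \<lparr>carrier = Inl ` {f \<in> extensional S. bounded (f ` S)},
      mult = undefined, one = undefined,
      zero = Inl (\<lambda>x\<in>S. 0),
      add = (\<lambda>f g. Inl (\<lambda>x\<in>S. bounded_part S f x + bounded_part S g x)),
      smult = (\<lambda>a f. Inl (\<lambda>x\<in>S. a * bounded_part S f x)),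
      vnorm = (\<lambda>f. SUP x\<in>S. cmod (bounded_part S f x))\<rparr>"

lemma bounded_functions_simps [simp]:
  "zero (bounded_functions S) = Inl (\<lambda>x\<in>S. 0)"
  "add (bounded_functions S) = (\<lambda>f g. Inl (\<lambda>x\<in>S. bounded_part S f x + bounded_part S g x))"
  "smult (bounded_functions S) = (\<lambda>a f. Inl (\<lambda>x\<in>S. a * bounded_part S f x))"
  by (simp_all add: bounded_functions_def)

lemma vnorm_bounded_functions: "vnorm (bounded_functions S) y = (SUP x\<in>S. cmod (bounded_part S y x))"
  by (simp add: bounded_functions_def)

lemma bounded_part_extensional [simp]: "bounded_part S y \<in> extensional S"
  by (simp add: bounded_part_def)

lemma bounded_bounded_part: "bounded (bounded_part S y ` S)"
proof (cases y)
  case (Inl f)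
  show ?thesis
  proof (cases "bounded (f ` S)")
    case True
    then have "bounded_part S y ` S = f ` S" using Inl by (auto simp: bounded_part_def)
    then show ?thesis using True by simp
  next
    case False
    then have "bounded_part S y ` S \<subseteq> {0}" using Inl by (auto simp: bounded_part_def)
    then show ?thesis by (rule bounded_subset[rotated]) simp
  qed
next
  case (Inr b)
  then have "bounded_part S y ` S \<subseteq> {0}" by (auto simp: bounded_part_def)
  then show ?thesis by (rule bounded_subset[rotated]) simp
qed

lemma bounded_part_Inl:
  assumes "f \<in> extensional S" "\<And>x. x \<in> S \<Longrightarrow> cmod (f x) \<le> B"
  shows "bounded_part S (Inl f) = f"
proof -
  have "bounded (f ` S)" using assms(2) by (auto simp: bounded_iff)
  then show ?thesis using assms(1) by (auto simp: bounded_part_def extensional_def fun_eq_iff)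
qed

text \<open>Membership as a fixed-point equation lets the laws of the space be settled by
  rewriting.\<close>

lemma carrier_bounded_functions_iff:
  "y \<in> carrier (bounded_functions S) \<longleftrightarrow> Inl (bounded_part S y) = y"
proof
  assume "y \<in> carrier (bounded_functions S)"
  then obtain f where "y = Inl f" "f \<in> extensional S" "bounded (f ` S)"
    by (auto simp: bounded_functions_def)
  then show "Inl (bounded_part S y) = y"
    by (auto simp: bounded_part_def extensional_def fun_eq_iff)
next
  assume "Inl (bounded_part S y) = y"
  then have "y = Inl (bounded_part S y)" by (rule sym)
  then show "y \<in> carrier (bounded_functions S)"
    using bounded_bounded_part[of S y] by (auto simp: bounded_functions_def)
qed

lemma Inl_in_bounded_functions:
  assumes "f \<in> extensional S" "\<And>x. x \<in> S \<Longrightarrow> cmod (f x) \<le> B"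
  shows "Inl f \<in> carrier (bounded_functions S)"
  using bounded_part_Inl[OF assms] by (simp add: carrier_bounded_functions_iff)

lemma bounded_part_restrict:
  assumes "\<And>x. x \<in> S \<Longrightarrow> cmod (f x) \<le> B"
  shows "bounded_part S (Inl (\<lambda>x\<in>S. f x)) = (\<lambda>x\<in>S. f x)"
  using assms by (intro bounded_part_Inl[of _ _ B]) auto

lemma bdd_above_bounded_part: "bdd_above ((\<lambda>x. cmod (bounded_part S y x)) ` S)"
  using bounded_bounded_part[of S y] by (auto simp: bounded_iff intro: bdd_aboveI2)

lemma norm_bounded_part_le:
  "x \<in> S \<Longrightarrow> cmod (bounded_part S y x) \<le> vnorm (bounded_functions S) y"
  unfolding vnorm_bounded_functions by (rule cSUP_upper[OF _ bdd_above_bounded_part])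

lemma vnorm_bounded_functions_le:
  assumes "S \<noteq> {}" "\<And>x. x \<in> S \<Longrightarrow> cmod (bounded_part S y x) \<le> B"
  shows "vnorm (bounded_functions S) y \<le> B"
  unfolding vnorm_bounded_functions using assms by (rule cSUP_least)

lemma bounded_part_zero [simp]: "bounded_part S (Inl (\<lambda>x\<in>S. 0)) = (\<lambda>x\<in>S. 0)"
  by (rule bounded_part_restrict[of _ _ 0]) simp

lemma bounded_part_add [simp]:
  "bounded_part S (Inl (\<lambda>x\<in>S. bounded_part S y x + bounded_part S z x)) =
     (\<lambda>x\<in>S. bounded_part S y x + bounded_part S z x)"
proof (rule bounded_part_restrict)
  fix x assume "x \<in> S"
  then show "cmod (bounded_part S y x + bounded_part S z x)
      \<le> vnorm (bounded_functions S) y + vnorm (bounded_functions S) z"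
    by (intro norm_triangle_mono norm_bounded_part_le)
qed

lemma bounded_part_smult [simp]:
  "bounded_part S (Inl (\<lambda>x\<in>S. a * bounded_part S y x)) = (\<lambda>x\<in>S. a * bounded_part S y x)"
proof (rule bounded_part_restrict)
  fix x assume "x \<in> S"
  then show "cmod (a * bounded_part S y x) \<le> cmod a * vnorm (bounded_functions S) y"
    by (simp add: norm_mult mult_left_mono norm_bounded_part_le)
qed

lemma restrict_bounded_part [simp]: "(\<lambda>x\<in>S. bounded_part S y x) = bounded_part S y"
  by (rule extensional_restrict) simp

text \<open>The operations see an argument only through \<open>bounded_part\<close>, so the inverse
  within the carrier exists and is unique even for \<open>z\<close> outside it. The distance is
  thereby under control on the whole type.\<close>

lemma minus_bounded_functions:
  fixes y z :: "('x \<Rightarrow> complex) + 'y"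
  shows "y \<ominus>\<^bsub>bounded_functions S\<^esub> z = Inl (\<lambda>x\<in>S. bounded_part S y x - bounded_part S z x)"
proof -
  let ?Y = "bounded_functions S :: (('x \<Rightarrow> complex) + 'y) normed_module"
  have "\<ominus>\<^bsub>?Y\<^esub> z = (-1) \<odot>\<^bsub>?Y\<^esub> z"
    unfolding a_inv_def m_inv_def
  proof (rule the_equality)
    show "(-1) \<odot>\<^bsub>?Y\<^esub> z \<in> carrier (add_monoid ?Y) \<and>
        z \<otimes>\<^bsub>add_monoid ?Y\<^esub> ((-1) \<odot>\<^bsub>?Y\<^esub> z) = \<one>\<^bsub>add_monoid ?Y\<^esub> \<and>
        ((-1) \<odot>\<^bsub>?Y\<^esub> z) \<otimes>\<^bsub>add_monoid ?Y\<^esub> z = \<one>\<^bsub>add_monoid ?Y\<^esub>"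
      using bounded_part_smult[of S "-1" z]
      by (auto simp: carrier_bounded_functions_iff cong: restrict_cong)
    fix w assume w: "w \<in> carrier (add_monoid ?Y) \<and> z \<otimes>\<^bsub>add_monoid ?Y\<^esub> w = \<one>\<^bsub>add_monoid ?Y\<^esub> \<and>
        w \<otimes>\<^bsub>add_monoid ?Y\<^esub> z = \<one>\<^bsub>add_monoid ?Y\<^esub>"
    then have "Inl (bounded_part S w) = w" by (simp add: carrier_bounded_functions_iff)
    moreover have "bounded_part S w x = - bounded_part S z x" if "x \<in> S" for x
    proof -
      from w have "(\<lambda>x\<in>S. bounded_part S w x + bounded_part S z x) = (\<lambda>x\<in>S. 0)" by simp
      from fun_cong[OF this, of x] that show ?thesis by (simp add: eq_neg_iff_add_eq_0)
    qed
    then have "bounded_part S w = (\<lambda>x\<in>S. -1 * bounded_part S z x)"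
      by (intro extensionalityI[of _ S]) auto
    ultimately show "w = (-1) \<odot>\<^bsub>?Y\<^esub> z" by simp
  qed
  then have "y \<ominus>\<^bsub>?Y\<^esub> z = y \<oplus>\<^bsub>?Y\<^esub> (-1) \<odot>\<^bsub>?Y\<^esub> z"
    by (simp only: a_minus_def)
  also have "\<dots> = Inl (\<lambda>x\<in>S. bounded_part S y x + (\<lambda>x\<in>S. (-1) * bounded_part S z x) x)"
    by (simp only: bounded_functions_simps bounded_part_smult)
  finally show ?thesis by (simp cong: restrict_cong)
qed

lemma bounded_part_minus:
  "bounded_part S (y \<ominus>\<^bsub>bounded_functions S\<^esub> z) = (\<lambda>x\<in>S. bounded_part S y x - bounded_part S z x)"
  unfolding minus_bounded_functions
proof (rule bounded_part_restrict)
  fix x assume "x \<in> S"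
  then show "cmod (bounded_part S y x - bounded_part S z x)
      \<le> vnorm (bounded_functions S) y + vnorm (bounded_functions S) z"
    by (intro order_trans[OF norm_triangle_ineq4] add_mono norm_bounded_part_le)
qed

lemma complex_normed_space_bounded_functions:
  fixes S :: "'x set"
  assumes S: "S \<noteq> {}"
  shows "complex_normed_space (bounded_functions S :: (('x \<Rightarrow> complex) + 'y) normed_module)"
proof -
  let ?Y = "bounded_functions S :: (('x \<Rightarrow> complex) + 'y) normed_module"
  have "abelian_group ?Y"
  proof (rule abelian_groupI)
    show "\<exists>y\<in>carrier ?Y. y \<oplus>\<^bsub>?Y\<^esub> x = \<zero>\<^bsub>?Y\<^esub>" for x
      using bounded_part_smult[of S "-1" x]
      by (intro bexI[of _ "(-1) \<odot>\<^bsub>?Y\<^esub> x"]) (auto simp: carrier_bounded_functions_iff cong: restrict_cong)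
  qed (auto simp: carrier_bounded_functions_iff add.assoc add.commute cong: restrict_cong)
  then have "module complex_field ?Y"
    by (intro moduleI cring_complex_field)
      (auto simp: carrier_bounded_functions_iff algebra_simps cong: restrict_cong)
  moreover have "complex_normed_space_axioms ?Y"
  proof
    fix x y a assume x: "x \<in> carrier ?Y"
    show "vnorm ?Y x = 0 \<longleftrightarrow> x = \<zero>\<^bsub>?Y\<^esub>"
    proof
      assume "vnorm ?Y x = 0"
      then have "bounded_part S x t = 0" if "t \<in> S" for t
        using norm_bounded_part_le[OF that, of x] by simp
      then have "bounded_part S x = (\<lambda>t\<in>S. 0)"
        by (intro extensionalityI[of _ S]) auto
      then show "x = \<zero>\<^bsub>?Y\<^esub>" using x by (simp add: carrier_bounded_functions_iff)
    qed (use S in \<open>simp add: vnorm_bounded_functions\<close>)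
    \<comment> \<open>One inequality for all scalars suffices: applied to \<open>inverse a\<close>
      it yields the reverse one.\<close>
    have le: "vnorm ?Y (c \<odot>\<^bsub>?Y\<^esub> z) \<le> cmod c * vnorm ?Y z" for c z
      by (intro vnorm_bounded_functions_le S) (simp add: norm_mult mult_left_mono norm_bounded_part_le)
    show "vnorm ?Y (a \<odot>\<^bsub>?Y\<^esub> x) = cmod a * vnorm ?Y x"
    proof (cases "a = 0")
      case True
      then show ?thesis using S by (simp add: vnorm_bounded_functions)
    next
      case False
      have "inverse a \<odot>\<^bsub>?Y\<^esub> (a \<odot>\<^bsub>?Y\<^esub> x) = x"
        using False x by (simp add: carrier_bounded_functions_iff mult.assoc[symmetric] cong: restrict_cong)
      then have "vnorm ?Y x \<le> cmod (inverse a) * vnorm ?Y (a \<odot>\<^bsub>?Y\<^esub> x)"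
        using le[of "inverse a" "a \<odot>\<^bsub>?Y\<^esub> x"] by (simp only:)
      then have "cmod a * vnorm ?Y x \<le> vnorm ?Y (a \<odot>\<^bsub>?Y\<^esub> x)"
        using False unfolding norm_inverse by (simp add: field_simps)
      then show ?thesis using le[of a x] by linarith
    qed
    show "vnorm ?Y (x \<oplus>\<^bsub>?Y\<^esub> y) \<le> vnorm ?Y x + vnorm ?Y y"
      by (intro vnorm_bounded_functions_le S) (simp add: norm_triangle_mono norm_bounded_part_le)
  qed
  ultimately show ?thesis by (intro complex_normed_space.intro)
qed

section \<open>The supremum metric and its completeness\<close>

lemma Metric_space_bounded_functions:
  fixes S :: "'x set"
  assumes S: "S \<noteq> {}"
  defines "Y \<equiv> bounded_functions S :: (('x \<Rightarrow> complex) + 'y) normed_module"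
  shows "Metric_space (carrier Y) (\<lambda>x y. vnorm Y (x \<ominus>\<^bsub>Y\<^esub> y))"
proof
  have bp: "t \<in> S \<Longrightarrow> bounded_part S (x \<ominus>\<^bsub>Y\<^esub> y) t = bounded_part S x t - bounded_part S y t" for x y t
    unfolding Y_def bounded_part_minus by simp
  have le: "t \<in> S \<Longrightarrow> cmod (bounded_part S x t - bounded_part S y t) \<le> vnorm Y (x \<ominus>\<^bsub>Y\<^esub> y)" for x y t
    using norm_bounded_part_le[of t S "x \<ominus>\<^bsub>Y\<^esub> y"] by (simp add: bp flip: Y_def)
  have least: "vnorm Y (x \<ominus>\<^bsub>Y\<^esub> y) \<le> B"
    if "\<And>t. t \<in> S \<Longrightarrow> cmod (bounded_part S x t - bounded_part S y t) \<le> B" for x y B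
    using vnorm_bounded_functions_le[OF S, of "x \<ominus>\<^bsub>Y\<^esub> y" B] that by (simp add: bp flip: Y_def)
  fix x y z
  obtain t where "t \<in> S" using S by blast
  from le[OF this] show "0 \<le> vnorm Y (x \<ominus>\<^bsub>Y\<^esub> y)" by (rule order_trans[OF norm_ge_zero])
  show "vnorm Y (x \<ominus>\<^bsub>Y\<^esub> y) = vnorm Y (y \<ominus>\<^bsub>Y\<^esub> x)"
    by (intro antisym least; subst norm_minus_commute; rule le)
  show "vnorm Y (x \<ominus>\<^bsub>Y\<^esub> z) \<le> vnorm Y (x \<ominus>\<^bsub>Y\<^esub> y) + vnorm Y (y \<ominus>\<^bsub>Y\<^esub> z)"
  proof (rule least)
    fix t assume t: "t \<in> S"
    show "cmod (bounded_part S x t - bounded_part S z t) \<le> vnorm Y (x \<ominus>\<^bsub>Y\<^esub> y) + vnorm Y (y \<ominus>\<^bsub>Y\<^esub> z)"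
      using le[OF t, of x y] le[OF t, of y z]
        norm_triangle_ineq[of "bounded_part S x t - bounded_part S y t" "bounded_part S y t - bounded_part S z t"]
      by simp
  qed
  assume xy: "x \<in> carrier Y" "y \<in> carrier Y"
  show "vnorm Y (x \<ominus>\<^bsub>Y\<^esub> y) = 0 \<longleftrightarrow> x = y"
  proof
    assume "vnorm Y (x \<ominus>\<^bsub>Y\<^esub> y) = 0"
    then have "bounded_part S x t = bounded_part S y t" if "t \<in> S" for t
      using le[OF that, of x y] by simp
    then have "bounded_part S x = bounded_part S y"
      by (intro extensionalityI[of _ S]) auto
    then show "x = y" using xy unfolding Y_def carrier_bounded_functions_iff by metis
  next
    assume "x = y"
    then have "vnorm Y (x \<ominus>\<^bsub>Y\<^esub> y) \<le> 0" by (intro least) simp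
    with \<open>0 \<le> vnorm Y (x \<ominus>\<^bsub>Y\<^esub> y)\<close> show "vnorm Y (x \<ominus>\<^bsub>Y\<^esub> y) = 0" by simp
  qed
qed

lemma complex_banach_space_bounded_functions:
  fixes S :: "'x set"
  assumes S: "S \<noteq> {}"
  shows "complex_banach_space (bounded_functions S :: (('x \<Rightarrow> complex) + 'y) normed_module)"
proof (intro complex_banach_space.intro complex_banach_space_axioms.intro
    complex_normed_space_bounded_functions S)
  let ?Y = "bounded_functions S :: (('x \<Rightarrow> complex) + 'y) normed_module"
  let ?d = "\<lambda>x y. vnorm ?Y (x \<ominus>\<^bsub>?Y\<^esub> y)"
  have le: "t \<in> S \<Longrightarrow> cmod (bounded_part S x t - bounded_part S y t) \<le> ?d x y" for x y t
    using norm_bounded_part_le[of t S "x \<ominus>\<^bsub>?Y\<^esub> y"] by (simp add: bounded_part_minus)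
  interpret Metric_space "carrier ?Y" ?d
    by (rule Metric_space_bounded_functions[OF S])
  show "mcomplete"
    unfolding mcomplete_def
  proof (intro allI impI)
    fix \<sigma> assume "MCauchy \<sigma>"
    then have carr: "\<sigma> n \<in> carrier ?Y"
      and cauchy: "\<epsilon> > 0 \<Longrightarrow> \<exists>N. \<forall>n n'. N \<le> n \<longrightarrow> N \<le> n' \<longrightarrow> ?d (\<sigma> n) (\<sigma> n') < \<epsilon>" for n \<epsilon>
      by (auto simp: MCauchy_def)
    define f where "f n = bounded_part S (\<sigma> n)" for n
    have "\<exists>l. (\<lambda>n. f n t) \<longlonglongrightarrow> l" if t: "t \<in> S" for t
    proof -
      have "Cauchy (\<lambda>n. f n t)"
      proof (rule metric_CauchyI)
        fix \<epsilon> :: real assume "\<epsilon> > 0"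
        from cauchy[OF this] le[OF t] show "\<exists>N. \<forall>m\<ge>N. \<forall>n\<ge>N. dist (f m t) (f n t) < \<epsilon>"
          unfolding f_def dist_norm by (meson order_le_less_trans)
      qed
      then show ?thesis by (simp add: Cauchy_convergent_iff convergent_def)
    qed
    then obtain g where g: "\<And>t. t \<in> S \<Longrightarrow> (\<lambda>n. f n t) \<longlonglongrightarrow> g t" by metis
    \<comment> \<open>Letting \<open>n'\<close> tend to infinity in the Cauchy estimate makes the
      pointwise convergence uniform.\<close>
    have lim: "cmod (f n t - g t) \<le> \<epsilon>"
      if N: "\<And>n'. N \<le> n' \<Longrightarrow> ?d (\<sigma> n) (\<sigma> n') < \<epsilon>" and t: "t \<in> S" for n N t \<epsilon>
    proof (rule LIMSEQ_le_const2)
      show "(\<lambda>n'. cmod (f n t - f n' t)) \<longlonglongrightarrow> cmod (f n t - g t)"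
        by (intro tendsto_intros g t)
      show "\<exists>N. \<forall>n'\<ge>N. cmod (f n t - f n' t) \<le> \<epsilon>"
        using N le[OF t] unfolding f_def by (meson less_imp_le order_trans)
    qed
    obtain N where N: "\<And>n'. N \<le> n' \<Longrightarrow> ?d (\<sigma> N) (\<sigma> n') < 1"
      using cauchy[of 1] by force
    have bg: "cmod (g t) \<le> vnorm ?Y (\<sigma> N) + 1" if t: "t \<in> S" for t
      using lim[of N N 1, OF N t] norm_bounded_part_le[OF t, of "\<sigma> N"] norm_triangle_sub[of "g t" "f N t"]
      unfolding f_def by (simp add: norm_minus_commute)
    let ?g = "Inl (\<lambda>t\<in>S. g t) :: ('x \<Rightarrow> complex) + 'y"
    have gc: "?g \<in> carrier ?Y" by (rule Inl_in_bounded_functions) (use bg in auto)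
    have bpg: "bounded_part S ?g = (\<lambda>t\<in>S. g t)" by (rule bounded_part_restrict) (rule bg)
    have "limitin mtopology \<sigma> ?g sequentially"
      unfolding limit_metric_sequentially
    proof (intro conjI gc allI impI)
      fix \<epsilon> :: real assume "\<epsilon> > 0"
      \<comment> \<open>Half of \<open>\<epsilon>\<close> restores the strict inequality that is
        lost in the limit.\<close>
      then obtain N where N: "\<And>n n'. N \<le> n \<Longrightarrow> N \<le> n' \<Longrightarrow> ?d (\<sigma> n) (\<sigma> n') < \<epsilon> / 2"
        using cauchy[of "\<epsilon> / 2"] by force
      have "?d (\<sigma> n) ?g < \<epsilon>" if n: "n \<ge> N" for n
      proof -
        have "?d (\<sigma> n) ?g \<le> \<epsilon> / 2"
          using lim[OF N[OF n]] unfolding f_def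
          by (intro vnorm_bounded_functions_le S) (simp add: bounded_part_minus bpg)
        then show ?thesis using \<open>\<epsilon> > 0\<close> by simp
      qed
      then show "\<exists>N. \<forall>n\<ge>N. \<sigma> n \<in> carrier ?Y \<and> ?d (\<sigma> n) ?g < \<epsilon>" using carr by blast
    qed
    then show "\<exists>x. limitin mtopology \<sigma> x sequentially" ..
  qed
qed

section \<open>Lower bound\<close>

text \<open>The character of frequency \<open>k - l\<close> in \<open>circle_power d\<close>. Pairs
  keep the exponents natural and match the double sum of the Fejer kernel.\<close>

definition circle_monomial :: "nat \<Rightarrow> nat \<times> nat \<Rightarrow> real^2 \<Rightarrow> complex" where
  "circle_monomial d = (\<lambda>(k, l). \<lambda>x\<in>unit_circle. circle_power d x ^ k * cnj (circle_power d x) ^ l)"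

lemma norm_circle_monomial:
  "x \<in> unit_circle \<Longrightarrow> cmod (circle_monomial d kl x) = 1"
  by (simp add: circle_monomial_def split_def norm_mult norm_power norm_circle_power del: mem_sphere_0)

lemma circle_monomial_adjacent:
  "circle_monomial d (Suc l, l) = harmonic d 1 0"
  "circle_monomial d (k, Suc k) = harmonic d 0 1"
proof -
  have *: "circle_power d x ^ k * cnj (circle_power d x) ^ k = 1" if "x \<in> unit_circle" for x k
    using unimodular_mult_cnj[OF norm_circle_power[OF that]] by (simp flip: power_mult_distrib)
  show "circle_monomial d (Suc l, l) = harmonic d 1 0" "circle_monomial d (k, Suc k) = harmonic d 0 1"
    unfolding circle_monomial_def harmonic_def prod.case
    by (rule restrict_ext; simp add: * mult.assoc mult.left_commute[of _ "cnj _"] del: mem_sphere_0)+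
qed

lemma sum_norm_fejer:
  assumes "m \<le> n" "cmod v = 1"
  shows "(\<Sum>k<n. cmod (fejer m (v * cnj (root_of_unity n k)))) = real n * real m"
proof -
  have "complex_of_real (\<Sum>k<n. cmod (fejer m (v * cnj (root_of_unity n k)))) =
      (\<Sum>k<n. fejer m (v * cnj (root_of_unity n k)))"
    unfolding of_real_sum by (intro sum.cong refl) (simp add: fejer_altdef norm_power)
  also have "\<dots> = complex_of_real (real n * real m)"
    using sum_fejer[OF assms] by simp
  finally show ?thesis by (simp only: of_real_eq_iff)
qed

text \<open>Each of the frequencies 1 and -1 is represented by \<open>m - 1\<close> pairs; this
  count is the origin of the factor \<open>(m - 1) / m\<close>.\<close>

lemma sum_adjacent:
  fixes a b :: complex
  assumes "m > 0"
  shows "(\<Sum>k<m. \<Sum>l<m. (if k = Suc l then a else 0) + (if l = Suc k then b else 0)) = (of_nat m - 1) * (a + b)"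
proof -
  obtain n where n: "m = Suc n" using assms by (cases m) auto
  have *: "(\<Sum>k<m. \<Sum>l<m. if l = Suc k then c else 0) = of_nat n * c" for c :: complex
  proof -
    have "(\<Sum>k<m. \<Sum>l<m. if l = Suc k then c else 0) = (\<Sum>k<m. if Suc k < m then c else 0)"
      by (intro sum.cong refl) simp
    also have "\<dots> = of_nat n * c" by (simp add: n)
    finally show ?thesis .
  qed
  have "(\<Sum>k<m. \<Sum>l<m. if k = Suc l then a else 0) = of_nat n * a"
    by (subst sum.swap) (rule *)
  with *[of b] show ?thesis
    by (simp add: sum.distrib n distrib_left)
qed

lemma norm_average_le:
  assumes "n > 0" "\<And>k. k < n \<Longrightarrow> cmod (f k) \<le> B"
  shows "cmod ((\<Sum>k<n. f k) / of_nat n) \<le> B"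
proof -
  have "cmod (\<Sum>k<n. f k) \<le> (\<Sum>k<n. B)"
    using assms(2) by (intro order_trans[OF norm_sum] sum_mono) auto
  then show ?thesis using assms(1) by (simp add: norm_divide field_simps)
qed

text \<open>
  In the proof, \<open>kt t\<close> is a Fejer mean of the sign of \<open>Re u\<close>, rotated by \<open>w t\<close>. Averaging \<open>Q (kt t)\<close>
  over the points \<open>pt t\<close> replaces \<open>Q\<close> by a rotation invariant projection, for which only the
  terms of frequency \<open>\<plusminus>1\<close> survive.
\<close>

lemma projection_norm_ge:
  fixes Q :: "(real^2 \<Rightarrow> complex) \<Rightarrow> real^2 \<Rightarrow> complex"
  assumes d: "d \<ge> 1" and m: "m \<ge> 2"
    and Q_range: "\<And>f. f \<in> B \<Longrightarrow> \<exists>a b. Q f = harmonic d a b"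
    and Q_id: "\<And>a b. Q (harmonic d a b) = harmonic d a b"
    and B_def: "B = {f \<in> extensional unit_circle. bounded (f ` unit_circle)}"
    and Q_sum: "\<And>A c g x. finite A \<Longrightarrow> (\<And>i. i \<in> A \<Longrightarrow> g i \<in> B) \<Longrightarrow> x \<in> unit_circle \<Longrightarrow>
      Q (\<lambda>x\<in>unit_circle. \<Sum>i\<in>A. c i * g i x) x = (\<Sum>i\<in>(A :: (nat \<times> nat) set). c i * Q (g i) x)"
    and Q_bound: "\<And>f x. f \<in> extensional unit_circle \<Longrightarrow> (\<And>x. x \<in> unit_circle \<Longrightarrow> cmod (f x) \<le> 1) \<Longrightarrow>
      x \<in> unit_circle \<Longrightarrow> cmod (Q f x) \<le> p"
  shows "(real m - 1) / real m * (2 / real m * cos_sum m 0) \<le> p"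
proof -
  define n where "n = 2 * m"
  define w where "w = root_of_unity n"
  define s where "s j = complex_of_real (sgn (cos (2 * pi * real j / real n)))" for j
  have n: "n > 0" "m \<le> n" using m by (auto simp: n_def)
  have "\<exists>x\<in>unit_circle. circle_power d x = w k" for k
    using circle_power_surj[OF d] by (simp add: w_def)
  then obtain pt where pt: "\<And>k. pt k \<in> unit_circle" "\<And>k. circle_power d (pt k) = w k"
    by metis
  let ?I = "{..<m} \<times> {..<m}"
  \<comment> \<open>Discrete Fourier coefficients of the signs \<open>s\<close>, divided by
    \<open>m\<close> to normalize \<open>fejer\<close>; \<open>c t\<close> is their rotation by
    \<open>w t\<close>.\<close>
  define e where "e = (\<lambda>(k, l). (\<Sum>j<n. s j * (w j ^ l * cnj (w j) ^ k)) / (of_nat n * of_nat m))"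
  define c where "c t = (\<lambda>(k, l). w t ^ l * cnj (w t) ^ k * e (k, l))" for t
  define kt where "kt t = (\<lambda>x\<in>unit_circle. \<Sum>i\<in>?I. c t i * circle_monomial d i x)" for t
  have mono_B: "circle_monomial d i \<in> B" for i
    unfolding B_def bounded_iff using norm_circle_monomial[of _ d i]
    by (auto simp: circle_monomial_def split_def simp del: mem_sphere_0 intro!: exI[of _ 1])
  \<comment> \<open>Two forms of one function: linearity of \<open>Q\<close> applies to the sum of
    monomials, while the bound by 1 is read off from the convolution of \<open>s\<close> with the
    Fejer kernel.\<close>
  have kt_eq: "kt t x = (\<Sum>j<n. s j * fejer m (circle_power d x * cnj (w t) * cnj (w j))) / (of_nat n * of_nat m)"
    if x: "x \<in> unit_circle" for t x
  proof -
    let ?u = "circle_power d x"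
    have "(\<Sum>j<n. s j * fejer m (?u * cnj (w t) * cnj (w j))) / (of_nat n * of_nat m) =
        (\<Sum>j<n. \<Sum>(k, l)\<in>?I. s j * ((w t * w j) ^ l * cnj (w t * w j) ^ k * (?u ^ k * cnj ?u ^ l))) / (of_nat n * of_nat m)"
      using fejer_sum[of m ?u "w t * w j" for j] by (simp add: sum_distrib_left split_def mult.assoc)
    also have "\<dots> = (\<Sum>(k, l)\<in>?I. \<Sum>j<n. s j * ((w t * w j) ^ l * cnj (w t * w j) ^ k * (?u ^ k * cnj ?u ^ l))) / (of_nat n * of_nat m)"
      by (subst sum.swap) (simp add: split_def)
    also have "\<dots> = (\<Sum>i\<in>?I. c t i * circle_monomial d i x)"
      unfolding sum_divide_distrib c_def e_def circle_monomial_def split_def restrict_apply'[OF x]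
      by (intro sum.cong refl)
        (simp add: sum_divide_distrib[symmetric] sum_distrib_left sum_distrib_right power_mult_distrib ac_simps)
    finally show ?thesis using x by (simp add: kt_def del: mem_sphere_0)
  qed
  have kt_le: "cmod (kt t x) \<le> 1" if x: "x \<in> unit_circle" for t x
  proof -
    let ?v = "circle_power d x * cnj (w t)"
    have "cmod (\<Sum>j<n. s j * fejer m (?v * cnj (w j))) \<le> (\<Sum>j<n. cmod (fejer m (?v * cnj (w j))))"
      by (intro order_trans[OF norm_sum] sum_mono) (auto simp: norm_mult s_def sgn_if)
    also have "\<dots> = real n * real m"
      unfolding w_def using norm_circle_power[OF x, of d] n
      by (intro sum_norm_fejer) (auto simp: norm_mult)
    finally show ?thesis using n m by (simp add: kt_eq[OF x] norm_divide norm_mult)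
  qed
  define T where "T i = (\<Sum>t<n. w t ^ snd i * cnj (w t) ^ fst i * Q (circle_monomial d i) (pt t)) / of_nat n" for i
  \<comment> \<open>The average extracts from \<open>Q (circle_monomial d (k, l))\<close> its part
    of frequency \<open>k - l\<close>. This is nonzero only for frequency 1 or -1, where
    \<open>Q\<close> fixes the monomial; all other coefficients of the image may be
    arbitrary.\<close>
  have T: "T (k, l) = (if k = Suc l then 1 else 0) + (if l = Suc k then 1 else 0)"
    if kl: "k < m" "l < m" for k l
  proof -
    obtain a b where ab: "Q (circle_monomial d (k, l)) = harmonic d a b"
      "k = Suc l \<Longrightarrow> a = 1" "l = Suc k \<Longrightarrow> b = 1"
    proof (cases "k = Suc l")
      case True
      show ?thesis
        by (rule that[of 1 0]) (simp_all add: True circle_monomial_adjacent Q_id)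
    next
      case k: False
      show ?thesis
      proof (cases "l = Suc k")
        case True
        show ?thesis
          by (rule that[of 0 1]) (simp_all add: True circle_monomial_adjacent Q_id)
      next
        case False
        obtain a b where "Q (circle_monomial d (k, l)) = harmonic d a b"
          using Q_range[OF mono_B] by blast
        then show ?thesis
          by (rule that) (simp_all add: k False)
      qed
    qed
    have "(\<Sum>t<n. w t ^ l * cnj (w t) ^ k * Q (circle_monomial d (k, l)) (pt t)) =
        a * (\<Sum>t<n. w t ^ Suc l * cnj (w t) ^ k) + b * (\<Sum>t<n. w t ^ l * cnj (w t) ^ Suc k)"
      unfolding ab(1) harmonic_def restrict_apply'[OF pt(1)] pt(2)
      by (simp add: sum_distrib_left sum.distrib distrib_left ac_simps)
    also have "\<dots> = a * (if Suc l = k then of_nat n else 0) + b * (if l = Suc k then of_nat n else 0)"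
      unfolding w_def using kl by (subst (1 2) sum_root_of_unity) (auto simp: n_def)
    finally show ?thesis
      using n ab(2,3) by (auto simp: T_def)
  qed
  have "(\<Sum>t<n. Q (kt t) (pt t)) / of_nat n = (\<Sum>t<n. \<Sum>i\<in>?I. c t i * Q (circle_monomial d i) (pt t)) / of_nat n"
    unfolding kt_def using pt(1) by (subst Q_sum) (auto intro: mono_B)
  also have "\<dots> = (\<Sum>i\<in>?I. e i * T i)"
    unfolding T_def c_def split_def
    by (subst sum.swap) (simp add: sum_distrib_left sum_divide_distrib ac_simps)
  also have "\<dots> = (\<Sum>k<m. \<Sum>l<m. (if k = Suc l then e (1, 0) else 0) + (if l = Suc k then e (0, 1) else 0))"
  proof -
    \<comment> \<open>Since \<open>w j\<close> is unimodular, \<open>e (k, l)\<close> depends only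
      on \<open>k - l\<close>.\<close>
    have ww: "w j ^ l * cnj (w j) ^ l = 1" for j l
      using unimodular_mult_cnj[of "w j"] by (simp add: w_def flip: power_mult_distrib)
    have "w j ^ l * cnj (w j) ^ Suc l = cnj (w j)" "w j ^ Suc l * cnj (w j) ^ l = w j" for j l
      using ww[of j l] by (simp_all add: mult.left_commute[of _ "cnj (w j)"] mult.assoc)
    note adj = this
    have "e (Suc l, l) = e (1, 0)" "e (l, Suc l) = e (0, 1)" for l
      unfolding e_def prod.case adj by simp_all
    then show ?thesis
      unfolding sum.cartesian_product by (intro sum.cong refl) (auto simp: T)
  qed
  also have "\<dots> = (of_nat m - 1) * (e (1, 0) + e (0, 1))"
    using m by (intro sum_adjacent) auto
  also have "e (1, 0) + e (0, 1) = of_real (2 * (2 * cos_sum m 0)) / (of_nat n * of_nat m)"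
  proof -
    \<comment> \<open>Pairing the sign of the cosine with both frequencies turns 2 cos into 2|cos|,
      so the L1-norm of the kernel appears.\<close>
    have "e (1, 0) + e (0, 1) = (\<Sum>j<n. s j * cnj (w j) + s j * w j) / (of_nat n * of_nat m)"
      by (simp add: e_def sum.distrib add_divide_distrib)
    also have "(\<Sum>j<n. s j * cnj (w j) + s j * w j) = (\<Sum>j<n. of_real (2 * \<bar>cos (0 + 2 * pi * real j / real n)\<bar>))"
    proof (rule sum.cong)
      fix j
      let ?t = "2 * pi * real j / real n"
      have "s j * cnj (w j) + s j * w j = of_real (2 * (sgn (cos ?t) * cos ?t))"
        by (simp add: s_def w_def root_of_unity_def complex_eq_iff)
      also have "sgn (cos ?t) * cos ?t = \<bar>cos (0 + ?t)\<bar>" by (simp add: abs_sgn mult.commute)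
      finally show "s j * cnj (w j) + s j * w j = of_real (2 * \<bar>cos (0 + ?t)\<bar>)" .
    qed simp
    also have "\<dots> = of_real (2 * (2 * cos_sum m 0))"
      unfolding of_real_sum[symmetric] sum_distrib_left[symmetric] n_def
      using m by (subst sum_abs_cos_double) auto
    finally show ?thesis .
  qed
  also have "(of_nat m - 1) * (of_real (2 * (2 * cos_sum m 0)) / (of_nat n * of_nat m)) =
      complex_of_real ((real m - 1) / real m * (2 / real m * cos_sum m 0))"
    using m by (simp add: n_def field_simps)
  finally have "complex_of_real ((real m - 1) / real m * (2 / real m * cos_sum m 0)) =
      (\<Sum>t<n. Q (kt t) (pt t)) / of_nat n" by (rule sym)
  moreover have "cmod ((\<Sum>t<n. Q (kt t) (pt t)) / of_nat n) \<le> p"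
    using n by (intro norm_average_le Q_bound kt_le pt) (auto simp: kt_def)
  ultimately have "cmod (complex_of_real ((real m - 1) / real m * (2 / real m * cos_sum m 0))) \<le> p"
    by (simp only:)
  then show ?thesis unfolding norm_of_real by linarith
qed

text \<open>Functions occupy the left summand of the type, so this test space is available for every
  \<open>'y\<close>. Each bounded projection is kept fixed while \<open>m\<close> tends to
  infinity.\<close>

lemma relative_projection_constant_ge_4_pi:
  fixes d :: nat
  assumes d: "d \<ge> 1"
  defines "Y \<equiv> bounded_functions unit_circle :: ((real^2 \<Rightarrow> complex) + 'y) normed_module"
  shows "ereal (4 / pi) \<le> relative_projection_constant (Inl ` carrier (circular_harmonics d)) Y"
  unfolding relative_projection_constant_def
proof (rule INF_greatest)
  let ?S = "unit_circle" and ?H = "circular_harmonics d"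
  let ?X = "Y\<lparr>carrier := Inl ` carrier ?H\<rparr>"
  note H = carrier_circular_harmonics_harmonic[OF d]
  interpret Y: complex_normed_space Y
    unfolding Y_def by (rule complex_normed_space_bounded_functions[OF unit_circle_nonempty])
  fix P assume "P \<in> {P \<in> bounded_operators Y ?X. \<forall>x\<in>Inl ` carrier ?H. P x = x}"
  then have P: "P \<in> linear_operators Y ?X" and P_id: "\<And>a b. P (Inl (harmonic d a b)) = Inl (harmonic d a b)"
    and "\<exists>C. \<forall>x\<in>carrier Y. vnorm ?X (P x) \<le> C * vnorm Y x"
    unfolding bounded_operators_def H by blast+
  then obtain C where C: "\<And>x. x \<in> carrier Y \<Longrightarrow> vnorm Y (P x) \<le> C * vnorm Y x"
    by auto
  have P_range: "\<exists>a b. P y = Inl (harmonic d a b)" if "y \<in> carrier Y" for y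
  proof -
    have "P y \<in> Inl ` carrier ?H"
      using P that unfolding linear_operators_def by auto
    then show ?thesis unfolding H by blast
  qed
  have P_add: "P (x \<oplus>\<^bsub>Y\<^esub> y) = P x \<oplus>\<^bsub>Y\<^esub> P y" if "x \<in> carrier Y" "y \<in> carrier Y" for x y
    using P that unfolding linear_operators_def by simp
  have P_smult: "P (a \<odot>\<^bsub>Y\<^esub> x) = a \<odot>\<^bsub>Y\<^esub> P x" if "x \<in> carrier Y" for a x
    using P that unfolding linear_operators_def by simp
  define B :: "(real^2 \<Rightarrow> complex) set" where "B = {f \<in> extensional ?S. bounded (f ` ?S)}"
  have Inl_B: "Inl f \<in> carrier Y \<longleftrightarrow> f \<in> B" for f
    by (auto simp: Y_def B_def bounded_functions_def)
  have bp_Inl: "bounded_part ?S (Inl f :: _ + 'y) = f" if "f \<in> B" for f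
    using Inl_B[of f] that by (simp add: Y_def carrier_bounded_functions_iff)
  have harmonic_B: "harmonic d a b \<in> B" for a b
    by (auto simp: B_def bounded_iff simp del: mem_sphere_0 circular_harmonics_simps
        intro!: exI[of _ "vnorm ?H (harmonic d a b)"] norm_harmonic_le)
  have Inl_add: "Inl f \<oplus>\<^bsub>Y\<^esub> Inl g = Inl (\<lambda>x\<in>?S. f x + g x)" if "f \<in> B" "g \<in> B" for f g
    by (simp add: Y_def bp_Inl that)
  have Inl_smult: "c \<odot>\<^bsub>Y\<^esub> Inl f = Inl (\<lambda>x\<in>?S. c * f x)" if "f \<in> B" for c f
    by (simp add: Y_def bp_Inl that)
  have sum_B: "(\<lambda>x\<in>?S. f x + g x) \<in> B" if "f \<in> B" "g \<in> B" for f g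
    using Y.M.a_closed[of "Inl f" "Inl g"] that by (simp add: Inl_B Inl_add)
  have smult_B: "(\<lambda>x\<in>?S. c * f x) \<in> B" if "f \<in> B" for c f
    using Y.smult_complex(1)[of "Inl f" c] that by (simp add: Inl_B Inl_smult)
  \<comment> \<open>This transports \<open>P\<close> to plain functions. \<open>projl\<close> is
    meaningful for \<open>f\<close> in \<open>B\<close>, where \<open>P (Inl f)\<close> is again of
    the form \<open>Inl\<close>.\<close>
  define Q where "Q f = projl (P (Inl f))" for f
  have P_Q: "P (Inl f) = Inl (Q f)" "\<exists>a b. Q f = harmonic d a b" "Q f \<in> B" if "f \<in> B" for f
  proof -
    have "Inl f \<in> carrier Y" using that Inl_B by simp
    from P_range[OF this] obtain a b where ab: "P (Inl f) = Inl (harmonic d a b)"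
      by (elim exE)
    then have Qf: "Q f = harmonic d a b" by (simp add: Q_def)
    show "P (Inl f) = Inl (Q f)" unfolding ab Qf ..
    show "\<exists>a b. Q f = harmonic d a b" unfolding Qf by blast
    show "Q f \<in> B" unfolding Qf by (rule harmonic_B)
  qed
  have Q_add: "Q (\<lambda>x\<in>?S. f x + g x) = (\<lambda>x\<in>?S. Q f x + Q g x)" if "f \<in> B" "g \<in> B" for f g
    using P_add[of "Inl f" "Inl g"] that
    by (simp add: Inl_B Inl_add P_Q sum_B)
  have Q_smult: "Q (\<lambda>x\<in>?S. c * f x) = (\<lambda>x\<in>?S. c * Q f x)" if "f \<in> B" for c f
    using P_smult[of "Inl f" c] that
    by (simp add: Inl_B Inl_smult P_Q smult_B)
  have zero_B: "(\<lambda>x\<in>?S. 0) \<in> B"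
    by (auto simp: B_def bounded_iff)
  \<comment> \<open>Membership in \<open>B\<close> is carried through the induction because
    \<open>Q_add\<close> asks for it.\<close>
  have Q_sum: "(\<lambda>x\<in>?S. \<Sum>i\<in>A. c i * g i x) \<in> B \<and>
      Q (\<lambda>x\<in>?S. \<Sum>i\<in>A. c i * g i x) = (\<lambda>x\<in>?S. \<Sum>i\<in>A. c i * Q (g i) x)"
    if "finite A" "\<And>i. i \<in> A \<Longrightarrow> g i \<in> B" for A :: "(nat \<times> nat) set" and c g
    using that
  proof (induction A rule: finite_induct)
    case empty
    have "Q (\<lambda>x\<in>?S. 0) = (\<lambda>x\<in>?S. 0)"
      using Q_smult[OF zero_B, of 0] by simp
    with zero_B show ?case
      unfolding sum.empty by (rule conjI)
  next
    case (insert j A)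
    let ?f = "\<lambda>x\<in>?S. c j * g j x" and ?h = "\<lambda>x\<in>?S. \<Sum>i\<in>A. c i * g i x"
    have fB: "?f \<in> B" using insert.prems by (intro smult_B) simp
    have "?h \<in> B \<and> Q ?h = (\<lambda>x\<in>?S. \<Sum>i\<in>A. c i * Q (g i) x)"
      by (rule insert.IH) (rule insert.prems, simp)
    note IH = conjunct1[OF this] conjunct2[OF this]
    have "(\<lambda>x\<in>?S. \<Sum>i\<in>insert j A. c i * g i x) = (\<lambda>x\<in>?S. ?f x + ?h x)"
      using insert.hyps by (intro restrict_ext) (simp del: mem_sphere_0)
    moreover have "Q (\<lambda>x\<in>?S. ?f x + ?h x) = (\<lambda>x\<in>?S. \<Sum>i\<in>insert j A. c i * Q (g i) x)"
      unfolding Q_add[OF fB IH(1)] IH(2) using insert.hyps insert.prems Q_smult[of "g j" "c j"]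
      by (intro restrict_ext) (simp del: mem_sphere_0)
    ultimately show ?case
      using sum_B[OF fB IH(1)] by (intro conjI) (simp_all only:)
  qed
  have Q_bound: "cmod (Q f x) \<le> operator_norm Y ?X P"
    if f: "f \<in> extensional ?S" "\<And>x. x \<in> ?S \<Longrightarrow> cmod (f x) \<le> 1" and x: "x \<in> ?S" for f x
  proof -
    have fB: "f \<in> B"
      unfolding Inl_B[symmetric] Y_def using f by (rule Inl_in_bounded_functions)
    have f1: "vnorm Y (Inl f) \<le> 1"
      unfolding Y_def using f(2) by (intro vnorm_bounded_functions_le unit_circle_nonempty) (simp add: bp_Inl[OF fB] del: mem_sphere_0)
    have "cmod (Q f x) \<le> vnorm Y (P (Inl f))"
      using norm_bounded_part_le[OF x, of "P (Inl f)"] by (simp add: P_Q(1) bp_Inl P_Q(3) fB Y_def)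
    also have "\<dots> \<le> operator_norm Y ?X P"
      unfolding operator_norm_def
    proof (rule cSUP_upper2)
      \<comment> \<open>Boundedness of \<open>P\<close> is what makes the real supremum in
        \<open>operator_norm\<close> an actual upper bound.\<close>
      show "bdd_above ((\<lambda>y. vnorm ?X (P y)) ` {y \<in> carrier Y. vnorm Y y \<le> 1})"
      proof (rule bdd_aboveI2)
        fix y assume y: "y \<in> {y \<in> carrier Y. vnorm Y y \<le> 1}"
        have "0 \<le> vnorm Y y"
          using norm_bounded_part_le[OF x, of y] unfolding Y_def by (rule order_trans[OF norm_ge_zero])
        then have "C * vnorm Y y \<le> \<bar>C\<bar> * 1"
          using y by (intro mult_mono) auto
        then show "vnorm ?X (P y) \<le> \<bar>C\<bar>" using C[of y] y by simp
      qed
      show "Inl f \<in> {y \<in> carrier Y. vnorm Y y \<le> 1}" using fB f1 by (simp add: Inl_B)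
    qed simp
    finally show ?thesis .
  qed
  have "(real m - 1) / real m * (2 / real m * (cos (pi / (2 * real m)) / sin (pi / (2 * real m))))
      \<le> operator_norm Y ?X P" if m: "m \<ge> 2" for m
  proof -
    have "(real m - 1) / real m * (2 / real m * cos_sum m 0) \<le> operator_norm Y ?X P"
    proof (rule projection_norm_ge[OF d m, where Q = Q and B = B])
      show "Q (harmonic d a b) = harmonic d a b" for a b by (simp add: Q_def P_id)
      show "Q (\<lambda>x\<in>?S. \<Sum>i\<in>A. c i * g i x) x = (\<Sum>i\<in>A. c i * Q (g i) x)"
        if "finite A" "\<And>i. i \<in> A \<Longrightarrow> g i \<in> B" "x \<in> ?S" for A :: "(nat \<times> nat) set" and c g x
        using Q_sum[of A g c] that by (simp del: mem_sphere_0)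
    qed (use P_Q(2) Q_bound B_def in blast)+
    moreover have "(real m - 1) / real m * (2 / real m * (cos (pi / (2 * real m)) / sin (pi / (2 * real m))))
        \<le> (real m - 1) / real m * (2 / real m * cos_sum m 0)"
      using m by (intro mult_left_mono cos_sum_bounds) auto
    ultimately show ?thesis by linarith
  qed
  then have "4 / pi \<le> operator_norm Y ?X P"
    by (intro LIMSEQ_le_const2[OF lower_constant_tendsto]) blast
  then show "ereal (4 / pi) \<le> ereal (operator_norm Y ?X P)" by simp
qed

section \<open>Combination of the two bounds\<close>

lemma Inl_isometric_embedding:
  assumes "d \<ge> 1"
  shows "Inl \<in> isometric_embeddings (circular_harmonics d) (bounded_functions unit_circle)"
proof -
  have bp: "bounded_part unit_circle (Inl (harmonic d a b)) = harmonic d a b" for a b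
    by (rule bounded_part_Inl[OF harmonic_extensional norm_harmonic_le])
  have "Inl (harmonic d a b) \<in> carrier (bounded_functions unit_circle)" for a b
    by (simp add: carrier_bounded_functions_iff bp)
  then show ?thesis
    by (auto simp: isometric_embeddings_def linear_operators_def
        carrier_circular_harmonics_harmonic[OF assms] bp vnorm_bounded_functions)
qed

theorem proposition4p2:
  fixes d :: nat
  assumes "d \<ge> 1"
  shows "projection_constant TYPE('y) (circular_harmonics d) = ereal (4 / pi)"
  unfolding projection_constant_def
proof (rule antisym)
  show "(SUP (Y :: ((real^2 \<Rightarrow> complex) + 'y) normed_module, I)\<in>{(Y, I). complex_banach_space Y \<and>
        I \<in> isometric_embeddings (circular_harmonics d) Y}.
      relative_projection_constant (I ` carrier (circular_harmonics d)) Y) \<le> ereal (4 / pi)"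
    using relative_projection_constant_le_4_pi assms by (intro SUP_least) auto
  show "ereal (4 / pi) \<le> (SUP (Y :: ((real^2 \<Rightarrow> complex) + 'y) normed_module, I)\<in>{(Y, I). complex_banach_space Y \<and>
        I \<in> isometric_embeddings (circular_harmonics d) Y}.
      relative_projection_constant (I ` carrier (circular_harmonics d)) Y)"
    using relative_projection_constant_ge_4_pi[OF assms, where 'y = 'y] assms
    by (intro SUP_upper2[of "(bounded_functions unit_circle, Inl)"])
      (auto intro: complex_banach_space_bounded_functions unit_circle_nonempty Inl_isometric_embedding)
qed

end
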